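(* Let $K$ be a field, let $G$ be a graph and let $k\geq2$. Suppose that, for every $1\leq r\leq k-1$, $G$ has no induced subgraph isomorphic to $C_{2r+1}\sqcup2K_{1}$. Then $$\operatorname{depth} S/I(G)^{(k)}\geq\operatorname{depth} S/I(G)^{k}.$$
   Context: All graphs are finite, without loops and multiple edges. For a graph $G$ on vertex set $[n]=\{1,\dots,n\}$ and the polynomial ring $S=K[x_1,\dots,x_n]$, the edge ideal is $I(G)=(x_ix_j : \{i,j\}\in E(G))\subset S$. For a squarefree monomial ideal $I$, the $k$-th symbolic power is $I^{(k)}=\bigcap_{P\in\operatorname{Min}(I)}P^k$, where $\operatorname{Min}(I)$ is the set of minimal primes of $I$; $I^k$ is the ordinary power. $\operatorname{depth}$ is taken with respect to the homogeneous maximal ideal $(x_1,\dots,x_n)$. $C_{2r+1}\sqcup 2K_1$ denotes the disjoint union of a cycle of length $2r+1$ and two isolated vertices. *)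

theory Defs
  imports
    "HOL-Algebra.Algebra"
    "HOL-Algebra.Algebraic_Closure_Type"
    "HOL-Library.Poly_Mapping"
    "HOL-Library.Extended_Nat"
begin

section \<open>Simple graphs\<close>

record 'v ugraph =
  verts :: "'v set"
  edges :: "'v set set"

definition simple_graph :: "'v ugraph \<Rightarrow> bool" where
  "simple_graph G \<longleftrightarrow> finite (verts G) \<and> (\<forall>e\<in>edges G. e \<subseteq> verts G \<and> card e = 2)"

definition induced_subgraph :: "'v ugraph \<Rightarrow> 'v set \<Rightarrow> 'v ugraph" where
  "induced_subgraph G W = \<lparr>verts = W, edges = {e \<in> edges G. e \<subseteq> W}\<rparr>"

definition graph_isomorphic :: "'v ugraph \<Rightarrow> 'w ugraph \<Rightarrow> bool" where
  "graph_isomorphic G H \<longleftrightarrow>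
     (\<exists>f. bij_betw f (verts G) (verts H) \<and> edges H = (\<lambda>e. f ` e) ` edges G)"

definition has_induced_copy :: "'v ugraph \<Rightarrow> 'w ugraph \<Rightarrow> bool" where
  "has_induced_copy G H \<longleftrightarrow>
     (\<exists>W. W \<subseteq> verts G \<and> graph_isomorphic (induced_subgraph G W) H)"

text \<open>This is the cycle of length \<open>m\<close> only for \<open>m \<ge> 3\<close>.\<close>

definition cycle_graph :: "nat \<Rightarrow> nat ugraph" where
  "cycle_graph m = \<lparr>verts = {..<m}, edges = {{i, (i + 1) mod m} | i. i < m}\<rparr>"

definition isolated_vertices :: "nat \<Rightarrow> nat ugraph" where
  "isolated_vertices m = \<lparr>verts = {..<m}, edges = {}\<rparr>"

definition disjoint_union :: "'v ugraph \<Rightarrow> 'w ugraph \<Rightarrow> ('v + 'w) ugraph" where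
  "disjoint_union G H =
     \<lparr>verts = verts G <+> verts H,
      edges = (\<lambda>e. Inl ` e) ` edges G \<union> (\<lambda>e. Inr ` e) ` edges H\<rparr>"


section \<open>Polynomial rings\<close>

text \<open>
  A monomial is a finitely supported exponent vector, and a polynomial is a finitely supported
  family of coefficients indexed by the monomials; the library's product on \<open>\<Rightarrow>\<^sub>0\<close> is convolution.
\<close>

type_synonym ('v, 'k) mpoly = "('v \<Rightarrow>\<^sub>0 nat) \<Rightarrow>\<^sub>0 'k"

definition var :: "'v \<Rightarrow> ('v, 'k::comm_ring_1) mpoly" where
  "var i = Poly_Mapping.single (Poly_Mapping.single i 1) 1"

text \<open>
  \<open>polynomial_ring V\<close> is the ring $K[x_i : i \in V]$. It is cut out of the polynomials in all
  variables of the type \<open>'v\<close>, so that the set of variables is a term and not a type.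
\<close>

definition polynomial_ring :: "'v set \<Rightarrow> ('v, 'k::comm_ring_1) mpoly ring" where
  "polynomial_ring V = ring_of_type_algebra
     \<lparr>carrier := {p. \<forall>m\<in>Poly_Mapping.keys p. Poly_Mapping.keys m \<subseteq> V}\<rparr>"

lemma cring_polynomial_ring: "cring (polynomial_ring V :: ('v, 'k::comm_ring_1) mpoly ring)"
proof -
  let ?T = "ring_of_type_algebra :: ('v, 'k) mpoly ring"
  let ?H = "{p :: ('v, 'k) mpoly. \<forall>m\<in>Poly_Mapping.keys p. Poly_Mapping.keys m \<subseteq> V}"
  interpret T: cring ?T
    by (rule cring_from_type_algebra)
  have ops: "carrier ?T = UNIV" "monoid.mult ?T = (*)" "\<one>\<^bsub>?T\<^esub> = 1" "\<zero>\<^bsub>?T\<^esub> = 0" "ring.add ?T = (+)"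
    by (simp_all add: ring_of_type_algebra_def fun_eq_iff)
  have inv: "\<ominus>\<^bsub>?T\<^esub> p = - p" for p
    by (rule T.minus_equality) (simp_all add: ops)
  have "subring ?H ?T"
  proof (rule T.subringI)
    show "?H \<subseteq> carrier ?T"
      by (simp add: ops)
    show "\<one>\<^bsub>?T\<^esub> \<in> ?H"
      by (simp add: ops)
    show "\<ominus>\<^bsub>?T\<^esub> p \<in> ?H" if "p \<in> ?H" for p
      using that by (simp add: inv)
    show "p \<otimes>\<^bsub>?T\<^esub> q \<in> ?H" if "p \<in> ?H" "q \<in> ?H" for p q
    proof -
      have "Poly_Mapping.keys m \<subseteq> V" if m: "m \<in> Poly_Mapping.keys (p * q)" for m
      proof -
        from m keys_mult[of p q] obtain a b where
          "m = a + b" "a \<in> Poly_Mapping.keys p" "b \<in> Poly_Mapping.keys q"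
          by blast
        with \<open>p \<in> ?H\<close> \<open>q \<in> ?H\<close> show ?thesis
          using Poly_Mapping.keys_add[of a b] by blast
      qed
      then show ?thesis
        by (simp add: ops)
    qed
    show "p \<oplus>\<^bsub>?T\<^esub> q \<in> ?H" if "p \<in> ?H" "q \<in> ?H" for p q
      using that Poly_Mapping.keys_add[of p q] by (auto simp: ops)
  qed
  then show ?thesis
    unfolding polynomial_ring_def
    using T.subcring_iff[of ?H] T.subcringI' by (simp add: ops)
qed

definition edge_ideal :: "'v ugraph \<Rightarrow> ('v, 'k::comm_ring_1) mpoly set" where
  "edge_ideal G =
     Idl\<^bsub>polynomial_ring (verts G)\<^esub> {var i * var j | i j. {i, j} \<in> edges G}"

definition variable_ideal :: "'v set \<Rightarrow> ('v, 'k::comm_ring_1) mpoly set" where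
  "variable_ideal V = Idl\<^bsub>polynomial_ring V\<^esub> (var ` V)"


section \<open>Ordinary and symbolic powers\<close>

definition ideal_power :: "('a, 'b) ring_scheme \<Rightarrow> 'a set \<Rightarrow> nat \<Rightarrow> 'a set" where
  "ideal_power R I k = I [^]\<^bsub>ideals_set R\<^esub> k"

definition minimal_primes :: "('a, 'b) ring_scheme \<Rightarrow> 'a set \<Rightarrow> 'a set set" where
  "minimal_primes R I =
     {P. primeideal P R \<and> I \<subseteq> P \<and>
         (\<forall>Q. primeideal Q R \<and> I \<subseteq> Q \<and> Q \<subseteq> P \<longrightarrow> Q = P)}"

text \<open>
  This form of the definition, without localization, is the one for squarefree monomial ideals.
  Their minimal primes are generated by variables, so the powers of these primes are primary.
\<close>

definition symbolic_power :: "('a, 'b) ring_scheme \<Rightarrow> 'a set \<Rightarrow> nat \<Rightarrow> 'a set" where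
  "symbolic_power R I k = carrier R \<inter> (\<Inter>P\<in>minimal_primes R I. ideal_power R P k)"


section \<open>Depth\<close>

definition nonzerodivisor :: "('a, 'b) ring_scheme \<Rightarrow> 'a \<Rightarrow> bool" where
  "nonzerodivisor A a \<longleftrightarrow>
     a \<in> carrier A \<and> (\<forall>b\<in>carrier A. a \<otimes>\<^bsub>A\<^esub> b = \<zero>\<^bsub>A\<^esub> \<longrightarrow> b = \<zero>\<^bsub>A\<^esub>)"

text \<open>
  \<open>fs\<close> is a regular sequence on the module $R/J$. The quotient of $R/J$ by the submodule
  $(f_1,\dots,f_i)(R/J)$ is taken in the form $R/(J + (f_1,\dots,f_i))$.
\<close>

definition regular_sequence_on_quotient ::
  "('a, 'b) ring_scheme \<Rightarrow> 'a set \<Rightarrow> 'a list \<Rightarrow> bool" where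
  "regular_sequence_on_quotient R J fs \<longleftrightarrow>
     set fs \<subseteq> carrier R \<and>
     (\<forall>i<length fs. let L = Idl\<^bsub>R\<^esub> (J \<union> set (take i fs)) in
        nonzerodivisor (R Quot L) (L +>\<^bsub>R\<^esub> (fs ! i))) \<and>
     Idl\<^bsub>R\<^esub> (J \<union> set fs) \<noteq> carrier R"

text \<open>
  The depth of $R/J$ with respect to the ideal \<open>M\<close>, for a proper ideal \<open>J\<close>.
\<close>

definition depth_quotient :: "('a, 'b) ring_scheme \<Rightarrow> 'a set \<Rightarrow> 'a set \<Rightarrow> enat" where
  "depth_quotient R M J =
     (SUP fs \<in> {fs. regular_sequence_on_quotient R J fs \<and> set fs \<subseteq> M}. enat (length fs))"

end

theory Submission
  imports Defs "HOL-Library.Set_Algebras" "HOL-Library.Disjoint_Sets"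
begin

text \<open>
  The proof distinguishes whether \<open>G\<close> has an induced odd cycle of length \<open>2 * r + 1\<close> with
  \<open>1 \<le> r \<le> k - 1\<close>.

  If there is none, then the symbolic and the ordinary power are equal (\<open>symbolic_power_eq_power\<close>).
  A monomial lies in the symbolic power if and only if its degree on each vertex cover is at least
  \<open>k\<close>; it lies in the ordinary power if and only if it is divisible by a product of \<open>k\<close> edges. For a
  monomial with bipartite support, these conditions agree by Koenig's theorem, applied to the graph
  in which every vertex is replaced by as many copies as its exponent says. If the support is not
  bipartite, a shortest odd cycle in it is induced, so its length is at least \<open>2 * k + 1\<close> and it
  contains \<open>k\<close> disjoint edges.

  If there is such a cycle, then the depth for the ordinary power is at most one, and the depth for
  the symbolic power is at least one. For the first claim, let \<open>f\<close> be the product of the variables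
  of the cycle and of \<open>k - 1 - r\<close> copies of one of its edges. It has degree \<open>2 * k - 1\<close>, so it is not
  in $I^k$, but its product with any variable adjacent to the cycle is. The remaining vertices form a
  clique, because \<open>G\<close> has no induced copy of the cycle with two isolated vertices. So \<open>f\<close> or, with a
  vertex \<open>q\<close> of the clique, $x_q f$ is a monomial outside $I^k$ that all variables but at most one
  multiply into $I^k$ (\<open>socle_up_to_one_variable\<close>), and this excludes regular sequences of length two
  (\<open>regular_sequence_length_le_one\<close>). The second claim holds because $I^{(k)}$ is an intersection of
  powers of primes generated by proper subsets of the variables; the sum of all variables is regular
  modulo each of them (\<open>one_le_depth_symbolic_power\<close>).
\<close>

section \<open>Odd closed walks and Koenig's theorem\<close>

lemma relpow_sym:
  assumes "sym R" "(u, v) \<in> R ^^ n"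
  shows "(v, u) \<in> R ^^ n"
  using assms(2)
proof (induction n arbitrary: v)
  case (Suc n)
  then obtain w where "(u, w) \<in> R ^^ n" "(w, v) \<in> R"
    by auto
  with Suc.IH assms(1) show ?case
    by (meson relpow_Suc_I2 symD)
qed auto

text \<open>
  A vertex is coloured by the parity of the walks that reach it from a root chosen in its
  component. If two adjacent vertices had the same colour, then two walks of equal parity from the
  root to them, joined by the edge, would form an odd closed walk.
\<close>

lemma two_colouring_if_no_odd_closed_walk:
  assumes "sym R" and no_odd: "\<And>v n. odd n \<Longrightarrow> (v, v) \<notin> R ^^ n"
  shows "\<exists>col. \<forall>(u, v) \<in> R. col u \<noteq> (col v :: bool)"
proof -
  define root where "root v = (SOME u. \<exists>n. (u, v) \<in> R ^^ n)" for v
  define col where "col v = (\<exists>n. even n \<and> (root v, v) \<in> R ^^ n)" for v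
  have root: "\<exists>n. (root v, v) \<in> R ^^ n" for v
    unfolding root_def by (rule someI_ex) (intro exI[of _ v] exI[of _ 0], simp)
  have "col u \<noteq> col v" if uv: "(u, v) \<in> R" for u v
  proof
    have vu: "(v, u) \<in> R"
      using assms(1) uv by (meson symD)
    have "(\<exists>n. (w, u) \<in> R ^^ n) \<longleftrightarrow> (\<exists>n. (w, v) \<in> R ^^ n)" for w
      using uv vu by (meson relpow_Suc_I)
    then have eq: "root u = root v"
      unfolding root_def by simp
    assume same: "col u = col v"
    have "\<exists>m n. (root u, u) \<in> R ^^ m \<and> (root u, v) \<in> R ^^ n \<and> even (m + n)"
    proof (cases "col u")
      case True
      then show ?thesis
        using same eq unfolding col_def by force
    next
      case False
      then show ?thesis
        using same eq root[of u] root[of v] unfolding col_def by (metis even_add)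
    qed
    then obtain m n where mn: "(root u, u) \<in> R ^^ m" "(root u, v) \<in> R ^^ n" "even (m + n)"
      by blast
    have "(root u, root u) \<in> R ^^ (Suc m + n)"
      using relpow_Suc_I[OF mn(1) uv] relpow_sym[OF assms(1) mn(2)] relpow_add[of "Suc m" n R] by blast
    with no_odd[of "Suc m + n" "root u"] mn(3) show False
      by (simp del: relpow.simps)
  qed
  then show ?thesis
    by blast
qed

definition induced_cycle :: "('a \<times> 'a) set \<Rightarrow> nat \<Rightarrow> (nat \<Rightarrow> 'a) \<Rightarrow> bool" where
  "induced_cycle R m c \<longleftrightarrow> inj_on c {..<m} \<and>
     (\<forall>i<m. \<forall>j<m. (c i, c j) \<in> R \<longleftrightarrow> j = (i + 1) mod m \<or> i = (j + 1) mod m)"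

text \<open>
  A shortest odd closed walk is an induced cycle: a repeated vertex or a chord would split it into
  two shorter closed walks, one of them odd.
\<close>

lemma induced_odd_cycle_if_odd_closed_walk:
  assumes "sym R" "irrefl R" and ex: "odd n" "(v, v) \<in> R ^^ n"
  shows "\<exists>r\<ge>1. \<exists>c. induced_cycle R (2 * r + 1) c"
proof -
  define m where "m = (LEAST m. odd m \<and> (\<exists>v. (v, v) \<in> R ^^ m))"
  have m: "odd m" "\<exists>v. (v, v) \<in> R ^^ m"
    using LeastI[of "\<lambda>m. odd m \<and> (\<exists>v. (v, v) \<in> R ^^ m)" n] ex unfolding m_def by auto
  have least: "m \<le> l" if "odd l" "(v, v) \<in> R ^^ l" for l v
    unfolding m_def by (rule Least_le) (use that in auto)
  obtain c where c: "c 0 = c m" "\<And>i. i < m \<Longrightarrow> (c i, c (Suc i)) \<in> R"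
    using m(2) unfolding relpow_fun_conv by metis
  have arc: "(c i, c j) \<in> R ^^ (j - i)" if "i \<le> j" "j \<le> m" for i j
    unfolding relpow_fun_conv
    by (rule exI[of _ "\<lambda>t. c (i + t)"]) (use that c(2) in auto)
  have around: "(c j, c i) \<in> R ^^ (m - j + i)" if "i \<le> j" "j \<le> m" for i j
    using arc[of j m] arc[of 0 i] c(1) that relpow_add[of "m - j" i R] by fastforce
  \<comment> \<open>A shortcut of length \<open>d\<close> between two vertices of the walk splits it into two closed walks,
    one of which is odd when \<open>d \<le> 1\<close>.\<close>
  have split: "(odd (j - i + d) \<longrightarrow> m \<le> j - i + d) \<and> (odd (m - j + i + d) \<longrightarrow> m \<le> m - j + i + d)"
    if "i \<le> j" "j \<le> m" "(c i, c j) \<in> R ^^ d" for i j d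
  proof -
    have "(c i, c i) \<in> R ^^ (j - i + d)"
      using arc[OF that(1,2)] relpow_sym[OF assms(1) that(3)] relpow_add[of "j - i" d R] by blast
    moreover have "(c j, c j) \<in> R ^^ (m - j + i + d)"
      using around[OF that(1,2)] that(3) relpow_add[of "m - j + i" d R] by blast
    ultimately show ?thesis
      using least by blast
  qed
  have "m \<noteq> 1"
    using m(2) assms(2) by (auto simp: irrefl_def)
  then obtain r where r: "m = 2 * r + 1" "r \<ge> 1"
    using m(1) by (metis Suc_eq_plus1 add_0 less_one mult_0_right not_less oddE)
  have ne: "c i \<noteq> c j" if "i < j" "j < m" for i j
  proof
    assume "c i = c j"
    then have "(c i, c j) \<in> R ^^ 0"
      by simp
    from split[OF _ _ this] that m(1) show False
      by (cases "odd (j - i)") auto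
  qed
  have inj: "inj_on c {..<m}"
    by (intro linorder_inj_onI) (use ne in auto)
  have chord: "j = i + 1 \<or> i = 0 \<and> j = m - 1" if "i < j" "j < m" "(c i, c j) \<in> R" for i j
  proof -
    have "(c i, c j) \<in> R ^^ 1"
      using that(3) by simp
    from split[OF _ _ this] that m(1) show ?thesis
      by (cases "odd (j - i)") auto
  qed
  have edge: "(c i, c ((i + 1) mod m)) \<in> R" if "i < m" for i
    using c(2)[OF that] c(1) that by (cases "Suc i = m") auto
  have "(c i, c j) \<in> R \<longleftrightarrow> j = (i + 1) mod m \<or> i = (j + 1) mod m" if "i < m" "j < m" for i j
  proof
    assume R: "(c i, c j) \<in> R"
    then have R': "(c j, c i) \<in> R"
      using assms(1) by (meson symD)
    have "i \<noteq> j"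
      using R assms(2) by (auto simp: irrefl_def)
    then consider "i < j" | "j < i"
      by linarith
    then show "j = (i + 1) mod m \<or> i = (j + 1) mod m"
      using chord[of i j] chord[of j i] R R' that by cases auto
  next
    assume "j = (i + 1) mod m \<or> i = (j + 1) mod m"
    with edge that assms(1) show "(c i, c j) \<in> R"
      by (metis symD)
  qed
  with inj r show ?thesis
    unfolding induced_cycle_def by blast
qed

text \<open>
  Koenig's theorem, in the form that a bipartite graph without a vertex cover of fewer than \<open>k\<close>
  vertices has \<open>k\<close> disjoint edges. Edges are deleted as long as the covers stay that large; what
  remains is a critical graph, and a critical bipartite graph is a matching. Indeed, let two edges
  \<open>e\<close> and \<open>f\<close> share the vertex \<open>x\<close>, and let \<open>S e\<close> and \<open>S f\<close> be covers with fewer than \<open>k\<close> vertices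
  of the graphs without \<open>e\<close> and without \<open>f\<close>. Every edge that misses \<open>S e \<inter> S f\<close> lies inside the
  symmetric difference enlarged by \<open>x\<close>, so \<open>S e \<inter> S f\<close> and the smaller colour class of this set
  form a cover, which is too small.
\<close>

lemma koenig:
  fixes col :: "'a \<Rightarrow> bool"
  assumes "finite E" and "\<And>e. e \<in> E \<Longrightarrow> \<exists>u v. e = {u, v} \<and> col u \<noteq> col v"
    and "\<And>W. finite W \<Longrightarrow> (\<And>e. e \<in> E \<Longrightarrow> e \<inter> W \<noteq> {}) \<Longrightarrow> k \<le> card W"
  shows "\<exists>M\<subseteq>E. card M = k \<and> disjoint M"
  using assms
proof (induction E rule: finite_psubset_induct)
  case (psubset E)
  note bip = psubset.prems(1) and cov = psubset.prems(2)
  show ?case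
  proof (cases "\<exists>e\<in>E. \<forall>W. finite W \<longrightarrow> (\<forall>g\<in>E - {e}. g \<inter> W \<noteq> {}) \<longrightarrow> k \<le> card W")
    case True
    then obtain e where e: "e \<in> E" "\<And>W. finite W \<Longrightarrow> (\<And>g. g \<in> E - {e} \<Longrightarrow> g \<inter> W \<noteq> {}) \<Longrightarrow> k \<le> card W"
      by meson
    have "\<exists>M\<subseteq>E - {e}. card M = k \<and> disjoint M"
      by (rule psubset.IH) (use e bip in auto)
    then show ?thesis
      by blast
  next
    case False
    then have "\<forall>e\<in>E. \<exists>W. finite W \<and> (\<forall>g\<in>E - {e}. g \<inter> W \<noteq> {}) \<and> card W < k"
      by (meson not_le)
    then obtain S where S: "\<And>e. e \<in> E \<Longrightarrow> finite (S e)"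
      "\<And>e g. e \<in> E \<Longrightarrow> g \<in> E \<Longrightarrow> g \<noteq> e \<Longrightarrow> g \<inter> S e \<noteq> {}" "\<And>e. e \<in> E \<Longrightarrow> card (S e) < k"
      by (metis Diff_iff singletonD)
    have S_miss: "e \<inter> S e = {}" if "e \<in> E" for e
    proof (rule ccontr)
      assume "e \<inter> S e \<noteq> {}"
      then have "k \<le> card (S e)"
        using S that by (intro cov) metis+
      with S(3) that show False
        by fastforce
    qed
    have disj: "disjoint E"
    proof (rule ccontr)
      assume "\<not> disjoint E"
      then obtain e f x where ef: "e \<in> E" "f \<in> E" "e \<noteq> f" "x \<in> e" "x \<in> f"
        unfolding disjoint_def by blast
      define D where "D = insert x ((S e - S f) \<union> (S f - S e))"
      define Z where "Z = S e \<inter> S f"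
      have fin: "finite D" "finite Z" "finite (S e)" "finite (S f)"
        using S(1) ef unfolding D_def Z_def by auto
      have x: "x \<notin> S e" "x \<notin> S f"
        using S_miss ef by auto
      have "card D = Suc (card (S e - S f) + card (S f - S e))"
        unfolding D_def using x fin by (subst card_insert_disjoint) (auto simp: card_Un_disjoint Diff_Int_distrib2)
      moreover have "card (S e) = card (S e - S f) + card Z" "card (S f) = card (S f - S e) + card Z"
        unfolding Z_def using fin by (simp_all add: card_Diff_subset_Int card_mono Int_commute)
      ultimately have cD: "card D + 2 * card Z + 1 \<le> 2 * k"
        using S(3)[OF ef(1)] S(3)[OF ef(2)] by linarith
      have "card D = card {v \<in> D. col v} + card {v \<in> D. \<not> col v}"
        using fin by (subst card_Un_disjoint[symmetric]) (auto intro: arg_cong[of _ _ card])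
      then have "2 * card {v \<in> D. col v = True} \<le> card D \<or> 2 * card {v \<in> D. col v = False} \<le> card D"
        by simp linarith
      then obtain b where b: "2 * card {v \<in> D. col v = b} \<le> card D"
        by blast
      define T where "T = {v \<in> D. col v = b}"
      have "k \<le> card (T \<union> Z)"
      proof (rule cov)
        show "finite (T \<union> Z)"
          using fin unfolding T_def by auto
        fix g
        assume g: "g \<in> E"
        then obtain a c where ac: "g = {a, c}" "col a \<noteq> col c"
          using bip by blast
        have "g \<inter> Z \<noteq> {} \<or> g \<subseteq> D"
        proof -
          consider "g = e" | "g = f" | "g \<noteq> e" "g \<noteq> f"
            by blast
          then show ?thesis
          proof cases
            case 1
            then have "g \<inter> S f \<noteq> {}" "g \<inter> S e = {}"
              using S(2) S_miss ef by auto
            then show ?thesis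
              using 1 ac ef(4) x unfolding D_def by auto
          next
            case 2
            then have "g \<inter> S e \<noteq> {}" "g \<inter> S f = {}"
              using S(2) S_miss ef by auto
            then show ?thesis
              using 2 ac ef(5) x unfolding D_def by auto
          next
            case 3
            then have "g \<inter> S e \<noteq> {}" "g \<inter> S f \<noteq> {}"
              using S(2) ef g by auto
            then show ?thesis
              using ac unfolding D_def Z_def by auto
          qed
        qed
        then show "g \<inter> (T \<union> Z) \<noteq> {}"
          using ac unfolding T_def by auto
      qed
      also have "\<dots> \<le> card T + card Z"
        by (rule card_Un_le)
      \<comment> \<open>The set \<open>D\<close> has at most \<open>2 * k - 1 - 2 * card Z\<close> elements, so its smaller colour class has
        at most \<open>k - 1 - card Z\<close>.\<close>
      finally show False
        using b cD unfolding T_def by linarith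
    qed
    \<comment> \<open>One end of each edge gives a cover, so a matching has at least \<open>k\<close> edges.\<close>
    define W where "W = (\<lambda>e. SOME u. u \<in> e) ` E"
    have "k \<le> card W"
    proof (rule cov)
      show "finite W"
        using psubset.hyps unfolding W_def by simp
      fix e
      assume "e \<in> E"
      then have "(SOME u. u \<in> e) \<in> e"
        using bip[of e] by (metis insertI1 someI)
      with \<open>e \<in> E\<close> show "e \<inter> W \<noteq> {}"
        unfolding W_def by blast
    qed
    also have "\<dots> \<le> card E"
      unfolding W_def using psubset.hyps by (rule card_image_le)
    finally obtain M where "M \<subseteq> E" "card M = k"
      by (meson obtain_subset_with_card_n)
    with disj show ?thesis
      unfolding disjoint_def by blast
  qed
qed

section \<open>Monomial ideals\<close>

lemma mpoly_eq_sum_terms: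
  fixes p :: "'a \<Rightarrow>\<^sub>0 'b::comm_monoid_add"
  shows "p = (\<Sum>m\<in>Poly_Mapping.keys p. Poly_Mapping.single m (Poly_Mapping.lookup p m))"
proof (rule poly_mapping_eqI)
  fix a
  have "Poly_Mapping.lookup (\<Sum>m\<in>Poly_Mapping.keys p. Poly_Mapping.single m (Poly_Mapping.lookup p m)) a
    = (\<Sum>m\<in>Poly_Mapping.keys p. if m = a then Poly_Mapping.lookup p a else 0)"
    unfolding lookup_sum by (intro sum.cong) (auto simp: lookup_single)
  also have "\<dots> = Poly_Mapping.lookup p a"
    by (simp add: in_keys_iff)
  finally show "Poly_Mapping.lookup p a
    = Poly_Mapping.lookup (\<Sum>m\<in>Poly_Mapping.keys p. Poly_Mapping.single m (Poly_Mapping.lookup p m)) a" ..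
qed

lemma lookup_single_mult:
  fixes p :: "('v \<Rightarrow>\<^sub>0 nat) \<Rightarrow>\<^sub>0 'k::comm_ring_1"
  shows "Poly_Mapping.lookup (Poly_Mapping.single a c * p) (a + b) = c * Poly_Mapping.lookup p b"
proof -
  have "Poly_Mapping.single a c * p
    = (\<Sum>m\<in>Poly_Mapping.keys p. Poly_Mapping.single (a + m) (c * Poly_Mapping.lookup p m))"
    by (subst (1) mpoly_eq_sum_terms[of p]) (simp add: sum_distrib_left mult_single)
  also have "Poly_Mapping.lookup \<dots> (a + b)
    = (\<Sum>m\<in>Poly_Mapping.keys p. if m = b then c * Poly_Mapping.lookup p b else 0)"
    unfolding lookup_sum by (intro sum.cong) (auto simp: lookup_single)
  also have "\<dots> = c * Poly_Mapping.lookup p b"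
    by (simp add: in_keys_iff)
  finally show ?thesis .
qed

text \<open>
  The span of the monomials whose exponents lie in \<open>U\<close>. Edge ideals, their
  powers and their symbolic powers have this form, so that statements about them become statements
  about sets of exponent vectors.
\<close>

definition mono_span :: "('v \<Rightarrow>\<^sub>0 nat) set \<Rightarrow> ('v, 'k::comm_ring_1) mpoly set" where
  "mono_span U = {p. Poly_Mapping.keys p \<subseteq> U}"

abbreviation mon :: "('v \<Rightarrow>\<^sub>0 nat) \<Rightarrow> ('v, 'k::comm_ring_1) mpoly" where
  "mon m \<equiv> Poly_Mapping.single m 1"

definition exps :: "'v set \<Rightarrow> ('v \<Rightarrow>\<^sub>0 nat) set" where
  "exps V = {m. Poly_Mapping.keys m \<subseteq> V}"

text \<open>
  The exponent sets of the monomial ideals of \<open>polynomial_ring V\<close>.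
\<close>

definition upward :: "'v set \<Rightarrow> ('v \<Rightarrow>\<^sub>0 nat) set \<Rightarrow> bool" where
  "upward V U \<longleftrightarrow> U \<subseteq> exps V \<and> U + exps V \<subseteq> U"

lemma mono_spanI: "(\<And>m. m \<in> Poly_Mapping.keys p \<Longrightarrow> m \<in> U) \<Longrightarrow> p \<in> mono_span U"
  by (auto simp: mono_span_def)

lemma mono_spanD: "p \<in> mono_span U \<Longrightarrow> m \<in> Poly_Mapping.keys p \<Longrightarrow> m \<in> U"
  by (auto simp: mono_span_def)

lemma single_in_mono_span: "m \<in> U \<Longrightarrow> Poly_Mapping.single m c \<in> mono_span U"
  by (auto simp: mono_span_def)

lemma mon_in_mono_span_iff [simp]: "mon m \<in> mono_span U \<longleftrightarrow> m \<in> U"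
  by (auto simp: mono_span_def)

lemma zero_in_mono_span [simp]: "0 \<in> mono_span U"
  by (auto simp: mono_span_def)

lemma add_in_mono_span: "p \<in> mono_span U \<Longrightarrow> q \<in> mono_span U \<Longrightarrow> p + q \<in> mono_span U"
  using Poly_Mapping.keys_add[of p q] by (auto simp: mono_span_def)

lemma uminus_in_mono_span: "p \<in> mono_span U \<Longrightarrow> - p \<in> mono_span U"
  by (auto simp: mono_span_def in_keys_iff)

lemma diff_in_mono_span: "p \<in> mono_span U \<Longrightarrow> q \<in> mono_span U \<Longrightarrow> p - q \<in> mono_span U"
  using add_in_mono_span[of p U "- q"] uminus_in_mono_span[of q U] by simp

lemma mult_in_mono_span: "p \<in> mono_span U \<Longrightarrow> q \<in> mono_span W \<Longrightarrow> p * q \<in> mono_span (U + W)"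
  using keys_mult[of p q] by (force simp: mono_span_def set_plus_def)

lemma mono_span_mono: "U \<subseteq> W \<Longrightarrow> mono_span U \<subseteq> mono_span W"
  by (auto simp: mono_span_def)

lemma mono_span_subset_iff: 
  "(mono_span U :: ('v, 'k::comm_ring_1) mpoly set) \<subseteq> mono_span W \<longleftrightarrow> U \<subseteq> W"
proof
  assume *: "(mono_span U :: ('v, 'k) mpoly set) \<subseteq> mono_span W"
  show "U \<subseteq> W"
  proof
    fix m
    assume "m \<in> U"
    then have "(mon m :: ('v, 'k) mpoly) \<in> mono_span U"
      by simp
    with * show "m \<in> W"
      by (meson subsetD mon_in_mono_span_iff)
  qed
qed (rule mono_span_mono)

lemma mono_span_subsetI:
  fixes J :: "('v, 'k::comm_ring_1) mpoly set"
  assumes "0 \<in> J" "\<And>p q. p \<in> J \<Longrightarrow> q \<in> J \<Longrightarrow> p + q \<in> J"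
    and "\<And>m c. m \<in> U \<Longrightarrow> Poly_Mapping.single m c \<in> J"
  shows "mono_span U \<subseteq> J"
proof
  fix p :: "('v, 'k) mpoly"
  assume p: "p \<in> mono_span U"
  have "(\<Sum>m\<in>K. Poly_Mapping.single m (Poly_Mapping.lookup p m)) \<in> J"
    if "finite K" "K \<subseteq> Poly_Mapping.keys p" for K
    using that by induction (use assms mono_spanD[OF p] in auto)
  then show "p \<in> J"
    by (subst mpoly_eq_sum_terms) auto
qed

lemma zero_in_exps [simp]: "0 \<in> exps V"
  by (simp add: exps_def)

lemma add_in_exps_iff [simp]: "a + b \<in> exps V \<longleftrightarrow> a \<in> exps V \<and> b \<in> exps V"
  by (auto simp: exps_def in_keys_iff lookup_add subset_iff)

lemma single_in_exps_iff [simp]: "Poly_Mapping.single i c \<in> exps V \<longleftrightarrow> c = 0 \<or> i \<in> V"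
  by (auto simp: exps_def)

lemma exps_minus: "a \<in> exps V \<Longrightarrow> a - b \<in> exps V"
  by (auto simp: exps_def in_keys_iff lookup_minus subset_iff)

lemma upwardD: "upward V U \<Longrightarrow> m \<in> U \<Longrightarrow> a \<in> exps V \<Longrightarrow> m + a \<in> U"
  unfolding upward_def by (meson set_plus_intro subsetD)

lemma upward_exps: "upward V (exps V)"
  unfolding upward_def by (auto elim!: set_plus_elim)

lemma upward_plus_exps: "A \<subseteq> exps V \<Longrightarrow> upward V (A + exps V)"
  unfolding upward_def
  by (auto elim!: set_plus_elim simp: add.assoc)

lemma split_off_variable:
  assumes "Poly_Mapping.lookup m i > 0"
  shows "m = Poly_Mapping.single i (1::nat) + (m - Poly_Mapping.single i 1)"
proof (rule poly_mapping_eqI)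
  fix j
  show "Poly_Mapping.lookup m j
    = Poly_Mapping.lookup (Poly_Mapping.single i 1 + (m - Poly_Mapping.single i 1)) j"
    using assms by (cases "i = j") (auto simp: lookup_add lookup_minus lookup_single)
qed

lemma polynomial_ring_simps [simp]:
  "carrier (polynomial_ring V) = mono_span (exps V)"
  "monoid.mult (polynomial_ring V) = (*)" "\<one>\<^bsub>polynomial_ring V\<^esub> = 1"
  "\<zero>\<^bsub>polynomial_ring V\<^esub> = 0" "ring.add (polynomial_ring V) = (+)"
  by (auto simp: polynomial_ring_def ring_of_type_algebra_def mono_span_def exps_def fun_eq_iff)

lemma one_in_polynomial_ring: "1 \<in> mono_span (exps V)"
  using mon_in_mono_span_iff[of 0 "exps V"] by simp

lemma mult_in_polynomial_ring:
  "p \<in> mono_span (exps V) \<Longrightarrow> q \<in> mono_span (exps V) \<Longrightarrow> p * q \<in> mono_span (exps V)"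
  using mult_in_mono_span[of p "exps V" q "exps V"] mono_span_mono[of "exps V + exps V" "exps V"]
    upward_exps[of V] unfolding upward_def by blast

lemma ideal_closed:
  fixes J :: "('v, 'k::comm_ring_1) mpoly set"
  assumes "ideal J (polynomial_ring V)"
  shows "0 \<in> J" "\<And>p q. p \<in> J \<Longrightarrow> q \<in> J \<Longrightarrow> p + q \<in> J"
    "\<And>p a. p \<in> J \<Longrightarrow> a \<in> mono_span (exps V) \<Longrightarrow> a * p \<in> J"
    "J \<subseteq> mono_span (exps V)" "\<And>p q. p \<in> J \<Longrightarrow> q \<in> J \<Longrightarrow> p - q \<in> J"
proof -
  show "0 \<in> J" "J \<subseteq> mono_span (exps V)"
    using additive_subgroup.zero_closed[OF ideal.axioms(1)[OF assms]]
      additive_subgroup.a_subset[OF ideal.axioms(1)[OF assms]] by simp_all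
  show add: "p + q \<in> J" if "p \<in> J" "q \<in> J" for p q
    using additive_subgroup.a_closed[OF ideal.axioms(1)[OF assms] that] by simp
  show mult: "a * p \<in> J" if "p \<in> J" "a \<in> mono_span (exps V)" for a p
    using ideal.I_l_closed[OF assms, of p a] that by simp
  show "p - q \<in> J" if "p \<in> J" "q \<in> J" for p q
    using add[OF that(1) mult[OF that(2) uminus_in_mono_span[OF one_in_polynomial_ring]]] by simp
qed

lemma ideal_mono_span:
  assumes "upward V U"
  shows "ideal (mono_span U) (polynomial_ring V :: ('v, 'k::comm_ring_1) mpoly ring)"
    (is "ideal ?J ?S")
proof -
  interpret cring ?S
    by (rule cring_polynomial_ring)
  have sub: "?J \<subseteq> mono_span (exps V)"
    using assms unfolding upward_def by (intro mono_span_mono) auto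
  have inv: "\<ominus>\<^bsub>?S\<^esub> p = - p" if "p \<in> mono_span (exps V)" for p
    by (rule minus_equality) (use that uminus_in_mono_span in auto)
  have mult: "a * p \<in> ?J" if "p \<in> ?J" "a \<in> mono_span (exps V)" for a p
    using mult_in_mono_span[OF that] mono_span_mono[of "U + exps V" U] assms
    unfolding upward_def by (auto simp: mult.commute)
  show ?thesis
  proof (rule idealI)
    show "subgroup ?J (add_monoid ?S)"
    proof (rule subgroup.intro)
      show "inv\<^bsub>add_monoid ?S\<^esub> p \<in> ?J" if "p \<in> ?J" for p
        using inv[of p] sub that uminus_in_mono_span[OF that] unfolding a_inv_def by auto
    qed (use sub in \<open>auto simp: add_in_mono_span\<close>)
  qed (use mult ring_axioms in \<open>auto simp: mult.commute\<close>)
qed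

lemma genideal_mons:
  assumes "A \<subseteq> exps V"
  shows "Idl\<^bsub>polynomial_ring V\<^esub> (mon ` A :: ('v, 'k::comm_ring_1) mpoly set) = mono_span (A + exps V)"
    (is "?L = _")
proof
  interpret cring "polynomial_ring V :: ('v, 'k) mpoly ring"
    by (rule cring_polynomial_ring)
  have car: "(mon ` A :: ('v, 'k) mpoly set) \<subseteq> carrier (polynomial_ring V)"
    using assms by auto
  have "(mon ` A :: ('v, 'k) mpoly set) \<subseteq> mono_span (A + exps V)"
    by (auto simp: set_plus_def) (metis add_0_right zero_in_exps)
  then show "?L \<subseteq> mono_span (A + exps V)"
    by (rule genideal_minimal[OF ideal_mono_span[OF upward_plus_exps[OF assms]]])
  note I = ideal_closed[OF genideal_ideal[OF car]]
  show "mono_span (A + exps V) \<subseteq> ?L"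
  proof (rule mono_span_subsetI)
    fix m and c :: 'k
    assume "m \<in> A + exps V"
    then obtain a b where ab: "m = a + b" "a \<in> A" "b \<in> exps V"
      by (auto elim: set_plus_elim)
    have "Poly_Mapping.single b c * mon a \<in> ?L"
      by (rule I(3)) (use ab genideal_self[OF car] in \<open>auto intro: single_in_mono_span\<close>)
    then show "Poly_Mapping.single m c \<in> ?L"
      by (simp add: ab mult_single add.commute)
  qed (use I in auto)
qed

lemma ideal_prod_mono_span:
  "ideal_prod (polynomial_ring V) (mono_span U) (mono_span W :: ('v, 'k::comm_ring_1) mpoly set) = mono_span (U + W)"
    (is "?L = _")
proof
  show "?L \<subseteq> mono_span (U + W)"
  proof
    fix p
    assume "p \<in> ?L"
    then show "p \<in> mono_span (U + W)"
      by induction (auto simp: mult_in_mono_span add_in_mono_span)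
  qed
  have prod: "p * q \<in> ?L" if "p \<in> mono_span U" "q \<in> mono_span W" for p q
    using ideal_prod.prod[OF that, of "polynomial_ring V"] by simp
  show "mono_span (U + W) \<subseteq> ?L"
  proof (rule mono_span_subsetI)
    show "0 \<in> ?L"
      using prod[of 0 0] by simp
    show "p + q \<in> ?L" if "p \<in> ?L" "q \<in> ?L" for p q
      using ideal_prod.sum[OF that] by simp
    fix m and c :: 'k
    assume "m \<in> U + W"
    then obtain a b where ab: "m = a + b" "a \<in> U" "b \<in> W"
      by (auto elim: set_plus_elim)
    then show "Poly_Mapping.single m c \<in> ?L"
      using prod[of "Poly_Mapping.single a c" "mon b"] by (simp add: single_in_mono_span mult_single)
  qed
qed

text \<open>
  The exponents of the power of a monomial ideal: sums of \<open>k\<close> elements of \<open>U\<close>. The zeroth power is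
  the whole ring, hence the value \<open>exps V\<close>.
\<close>

primrec sumset_power :: "'v set \<Rightarrow> ('v \<Rightarrow>\<^sub>0 nat) set \<Rightarrow> nat \<Rightarrow> ('v \<Rightarrow>\<^sub>0 nat) set" where
  "sumset_power V U 0 = exps V"
| "sumset_power V U (Suc k) = sumset_power V U k + U"

lemma ideal_power_mono_span:
  "ideal_power (polynomial_ring V) (mono_span U) k = mono_span (sumset_power V U k)"
  by (induction k)
    (simp_all add: ideal_power_def nat_pow_def ideals_set_def ideal_prod_mono_span)

lemma upward_sumset_power:
  assumes "upward V U"
  shows "upward V (sumset_power V U k)"
proof (induction k)
  case (Suc k)
  then show ?case
    using assms unfolding upward_def
    by (auto elim!: set_plus_elim simp: add.assoc subset_iff)
qed (simp add: upward_exps)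

lemma sumset_power_antimono:
  assumes "upward V U" "j \<le> k"
  shows "sumset_power V U k \<subseteq> sumset_power V U j"
proof -
  have "sumset_power V U (Suc k) \<subseteq> sumset_power V U k" for k
    using upwardD[OF upward_sumset_power[OF assms(1)]] assms(1)
    unfolding upward_def by (auto elim!: set_plus_elim)
  with assms(2) show ?thesis
    by (metis lift_Suc_antimono_le)
qed

lemma sum_in_sumset_power:
  assumes "finite M" "\<And>e. e \<in> M \<Longrightarrow> g e \<in> U"
  shows "sum g M \<in> sumset_power V U (card M)"
  using assms by (induction M rule: finite_induct) (auto simp: add.commute set_plus_intro)

lemma add_in_sumset_power:
  assumes "upward V U" "a \<in> sumset_power V U j" "b \<in> sumset_power V U l"
  shows "a + b \<in> sumset_power V U (j + l)"
  using assms(3)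
proof (induction l arbitrary: b)
  case 0
  then show ?case
    using upwardD[OF upward_sumset_power[OF assms(1)] assms(2)] by simp
next
  case (Suc l)
  then obtain b' u where "b = b' + u" "b' \<in> sumset_power V U l" "u \<in> U"
    by (auto elim: set_plus_elim)
  then show ?case
    using set_plus_intro[OF Suc.IH] by (simp add: add.assoc)
qed

text \<open>
  An additive weight that is at least \<open>c\<close> on the generators is at least \<open>c * k\<close> on the \<open>k\<close>-th power.
  Suitable weights thus certify that a monomial is not in a power.
\<close>

lemma sumset_power_weight:
  fixes w :: "('v \<Rightarrow>\<^sub>0 nat) \<Rightarrow> nat"
  assumes "\<And>a b. w (a + b) = w a + w b" "\<And>a. a \<in> U \<Longrightarrow> c \<le> w a" "m \<in> sumset_power V U k"
  shows "c * k \<le> w m"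
  using assms(3)
proof (induction k arbitrary: m)
  case (Suc k)
  then obtain a b where ab: "m = a + b" "a \<in> sumset_power V U k" "b \<in> U"
    by (auto elim: set_plus_elim)
  then show ?case
    using Suc.IH[OF ab(2)] assms(1,2) by fastforce
qed simp

lemma mono_span_split:
  fixes p :: "('v, 'k::comm_ring_1) mpoly"
  obtains p0 p1 where "p = p0 + p1" "p0 \<in> mono_span U" "p1 \<in> mono_span (- U)"
proof -
  let ?J = "{p :: ('v, 'k) mpoly. \<exists>p0\<in>mono_span U. \<exists>p1\<in>mono_span (- U). p = p0 + p1}"
  have "mono_span UNIV \<subseteq> ?J"
  proof (rule mono_span_subsetI)
    show "p + q \<in> ?J" if pq: "p \<in> ?J" "q \<in> ?J" for p q
    proof -
      obtain p0 p1 q0 q1 where "p = p0 + p1" "q = q0 + q1"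
        "p0 \<in> mono_span U" "q0 \<in> mono_span U" "p1 \<in> mono_span (- U)" "q1 \<in> mono_span (- U)"
        using pq by auto
      then have "p + q = (p0 + q0) + (p1 + q1)" "p0 + q0 \<in> mono_span U" "p1 + q1 \<in> mono_span (- U)"
        by (simp_all add: add_in_mono_span)
      then show ?thesis
        by blast
    qed
    show "Poly_Mapping.single m c \<in> ?J" for m :: "'v \<Rightarrow>\<^sub>0 nat" and c :: 'k
    proof (cases "m \<in> U")
      case True
      then have "Poly_Mapping.single m c = Poly_Mapping.single m c + 0" "Poly_Mapping.single m c \<in> mono_span U"
        by (simp_all add: single_in_mono_span)
      then show ?thesis
        using zero_in_mono_span by blast
    next
      case False
      then have "Poly_Mapping.single m c = 0 + Poly_Mapping.single m c" "Poly_Mapping.single m c \<in> mono_span (- U)"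
        by (simp_all add: single_in_mono_span)
      then show ?thesis
        using zero_in_mono_span by blast
    qed
    show "0 \<in> ?J"
      by (auto intro!: bexI[of _ 0])
  qed
  then have "p \<in> ?J"
    by (auto simp: mono_span_def)
  then show ?thesis
    using that by auto
qed

text \<open>
  The parts of lowest weight of two polynomials multiply to the part of lowest weight of the
  product, which is nonzero because the polynomial ring is a domain. So the lowest weights add up,
  and a factor \<open>p\<close> with lowest weight zero does not change the lowest weight of \<open>q\<close>.
\<close>

lemma weight_filtration_primary:
  fixes w :: "('v::linorder \<Rightarrow>\<^sub>0 nat) \<Rightarrow> nat" and p q :: "('v, 'k::idom) mpoly"
  assumes w: "\<And>a b. w (a + b) = w a + w b"
    and pq: "p * q \<in> mono_span {m. k \<le> w m}" and p: "p \<notin> mono_span {m. 1 \<le> w m}"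
  shows "q \<in> mono_span {m. k \<le> w m}"
proof (rule ccontr)
  assume "q \<notin> mono_span {m. k \<le> w m}"
  then obtain b where b: "b \<in> Poly_Mapping.keys q" "w b < k"
    unfolding mono_span_def by (auto simp: not_le subset_iff)
  define d where "d = (LEAST d. \<exists>m\<in>Poly_Mapping.keys q. w m = d)"
  have d: "\<exists>m\<in>Poly_Mapping.keys q. w m = d" "\<And>m. m \<in> Poly_Mapping.keys q \<Longrightarrow> d \<le> w m"
    unfolding d_def by (rule LeastI_ex) (use b in \<open>auto intro: Least_le\<close>)
  have "d < k"
    using d(2)[OF b(1)] b(2) by simp
  obtain p0 p1 where p01: "p = p0 + p1" "p0 \<in> mono_span {m. w m = 0}" "p1 \<in> mono_span (- {m. w m = 0})"
    by (rule mono_span_split)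
  obtain q0 q1 where q01: "q = q0 + q1" "q0 \<in> mono_span {m. w m = d}" "q1 \<in> mono_span (- {m. w m = d})"
    by (rule mono_span_split)
  have "p0 \<noteq> 0"
    using p p01 by (auto simp: mono_span_def)
  moreover have "q0 \<noteq> 0"
    using d(1) q01 by (auto simp: mono_span_def)
  ultimately obtain m where m: "m \<in> Poly_Mapping.keys (p0 * q0)"
    by (metis keys_eq_empty all_not_in_conv mult_eq_0_iff)
  then have wm: "w m = d"
    using keys_mult[of p0 q0] mono_spanD[OF p01(2)] mono_spanD[OF q01(2)] w by force
  have q1: "q1 \<in> mono_span {m. d < w m}"
  proof (rule mono_spanI)
    fix m
    assume m: "m \<in> Poly_Mapping.keys q1"
    then have ne: "w m \<noteq> d"
      using mono_spanD[OF q01(3)] by auto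
    then have "m \<notin> Poly_Mapping.keys q0"
      using mono_spanD[OF q01(2)] by auto
    then have "m \<in> Poly_Mapping.keys q"
      using m unfolding q01(1) by (simp add: in_keys_iff lookup_add)
    then show "m \<in> {m. d < w m}"
      using d(2) ne by force
  qed
  have q: "q \<in> mono_span {m. d \<le> w m}"
    using d(2) by (auto intro: mono_spanI)
  have "p1 * q \<in> mono_span {m. d < w m}"
    using mult_in_mono_span[OF p01(3) q] mono_span_mono[of _ "{m. d < w m}"] w
    by (rule_tac subsetD[OF mono_span_mono]) (auto elim!: set_plus_elim)
  moreover have "p0 * q1 \<in> mono_span {m. d < w m}"
    using mult_in_mono_span[OF p01(2) q1] w
    by (rule_tac subsetD[OF mono_span_mono]) (auto elim!: set_plus_elim)
  ultimately have "p1 * q + p0 * q1 \<in> mono_span {m. d < w m}"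
    by (rule add_in_mono_span)
  then have "m \<notin> Poly_Mapping.keys (p1 * q + p0 * q1)"
    using wm by (auto simp: mono_span_def)
  moreover have "p * q = p0 * q0 + (p1 * q + p0 * q1)"
    unfolding p01(1) q01(1) by (simp add: algebra_simps)
  ultimately have "m \<in> Poly_Mapping.keys (p * q)"
    using m by (simp add: in_keys_iff lookup_add)
  with pq wm \<open>d < k\<close> show False
    by (auto simp: mono_span_def)
qed

section \<open>Primes generated by variables\<close>

definition deg_on :: "'v set \<Rightarrow> ('v \<Rightarrow>\<^sub>0 nat) \<Rightarrow> nat" where
  "deg_on C m = (\<Sum>i\<in>C. Poly_Mapping.lookup m i)"

lemma deg_on_add: "deg_on C (a + b) = deg_on C a + deg_on C b"
  by (simp add: deg_on_def lookup_add sum.distrib)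

lemma deg_on_single: "finite C \<Longrightarrow> deg_on C (Poly_Mapping.single i c) = (if i \<in> C then c else 0)"
  by (simp add: deg_on_def lookup_single when_def sum.delta)

text \<open>
  The exponents of the \<open>k\<close>-th power of the prime ideal $(x_i : i \in C)$.
\<close>

definition prime_power_exps :: "'v set \<Rightarrow> 'v set \<Rightarrow> nat \<Rightarrow> ('v \<Rightarrow>\<^sub>0 nat) set" where
  "prime_power_exps V C k = {m \<in> exps V. k \<le> deg_on C m}"

abbreviation prime_on :: "'v set \<Rightarrow> 'v set \<Rightarrow> ('v, 'k::comm_ring_1) mpoly set" where
  "prime_on V C \<equiv> mono_span (prime_power_exps V C 1)"

lemma upward_prime_power_exps: "upward V (prime_power_exps V C k)"
  by (auto simp: upward_def prime_power_exps_def deg_on_add elim!: set_plus_elim)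

lemma sumset_power_prime:
  assumes "finite C" "C \<subseteq> V"
  shows "sumset_power V (prime_power_exps V C 1) k = prime_power_exps V C k"
proof
  show "sumset_power V (prime_power_exps V C 1) k \<subseteq> prime_power_exps V C k"
    using sumset_power_weight[of "deg_on C" "prime_power_exps V C 1" 1 _ V k]
      upward_sumset_power[OF upward_prime_power_exps, of V C 1 k]
    by (auto simp: prime_power_exps_def deg_on_add upward_def)
  show "prime_power_exps V C k \<subseteq> sumset_power V (prime_power_exps V C 1) k"
  proof (induction k)
    case (Suc k)
    show ?case
    proof
      fix m
      assume "m \<in> prime_power_exps V C (Suc k)"
      then have m: "m \<in> exps V" "Suc k \<le> deg_on C m"
        by (auto simp: prime_power_exps_def)
      then obtain i where i: "i \<in> C" "Poly_Mapping.lookup m i > 0"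
        unfolding deg_on_def by (metis Suc_le_D bot_nat_0.not_eq_extremum nat.discI sum.neutral)
      define m' where "m' = m - Poly_Mapping.single i 1"
      have "m = Poly_Mapping.single i 1 + m'"
        unfolding m'_def by (rule split_off_variable[OF i(2)])
      moreover from this have "m' \<in> prime_power_exps V C k"
        using m i(1) assms by (auto simp: prime_power_exps_def deg_on_add deg_on_single)
      moreover have "Poly_Mapping.single i 1 \<in> prime_power_exps V C 1"
        using i(1) assms by (auto simp: prime_power_exps_def deg_on_single)
      ultimately have "m' + Poly_Mapping.single i 1 \<in> sumset_power V (prime_power_exps V C 1) (Suc k)"
        unfolding sumset_power.simps by (intro set_plus_intro subsetD[OF Suc.IH])
      then show "m \<in> sumset_power V (prime_power_exps V C 1) (Suc k)"
        unfolding \<open>m = Poly_Mapping.single i 1 + m'\<close> by (simp only: add.commute)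
    qed
  qed (auto simp: prime_power_exps_def)
qed

lemma var_eq_mon: "var i = mon (Poly_Mapping.single i 1)"
  by (simp add: var_def)

text \<open>
  The powers of a prime generated by variables are primary. For \<open>k = 1\<close> this is primality.
\<close>

lemma prime_on_primary:
  fixes p q :: "('v::linorder, 'k::idom) mpoly"
  assumes "p \<in> mono_span (exps V)" "q \<in> mono_span (exps V)"
    and "p * q \<in> mono_span (prime_power_exps V C k)" "p \<notin> prime_on V C"
  shows "q \<in> mono_span (prime_power_exps V C k)"
proof -
  have eq: "r \<in> mono_span (prime_power_exps V C j) \<longleftrightarrow> r \<in> mono_span {m. j \<le> deg_on C m}"
    if "r \<in> mono_span (exps V)" for j and r :: "('v, 'k) mpoly"
    using that by (auto simp: mono_span_def prime_power_exps_def)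
  show ?thesis
    using weight_filtration_primary[of "deg_on C" p q k] assms eq mult_in_polynomial_ring
    by (metis deg_on_add)
qed

lemma primeideal_prime_on:
  fixes V :: "'v::linorder set"
  shows "primeideal (prime_on V C :: ('v, 'k::idom) mpoly set) (polynomial_ring V)"
proof (rule primeidealI)
  show "ideal (prime_on V C :: ('v, 'k) mpoly set) (polynomial_ring V)"
    by (rule ideal_mono_span[OF upward_prime_power_exps])
  show "cring (polynomial_ring V :: ('v, 'k) mpoly ring)"
    by (rule cring_polynomial_ring)
  have "(1 :: ('v, 'k) mpoly) \<notin> prime_on V C"
    by (auto simp: mono_span_def prime_power_exps_def deg_on_def)
  then show "carrier (polynomial_ring V) \<noteq> (prime_on V C :: ('v, 'k) mpoly set)"
    using one_in_polynomial_ring by auto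
  show "p \<in> prime_on V C \<or> q \<in> prime_on V C"
    if "p \<in> carrier (polynomial_ring V)" "q \<in> carrier (polynomial_ring V)"
      "p \<otimes>\<^bsub>polynomial_ring V\<^esub> q \<in> prime_on V C" for p q :: "('v, 'k) mpoly"
    using that prime_on_primary[of p V q C 1] by auto
qed

lemma prime_on_subset:
  fixes P :: "('v, 'k::comm_ring_1) mpoly set"
  assumes "ideal P (polynomial_ring V)" "\<And>i. i \<in> C \<Longrightarrow> var i \<in> P"
  shows "prime_on V C \<subseteq> P"
proof (rule mono_span_subsetI)
  note I = ideal_closed[OF assms(1)]
  fix m and c :: 'k
  assume m: "m \<in> prime_power_exps V C 1"
  then obtain i where i: "i \<in> C" "Poly_Mapping.lookup m i > 0"
    unfolding deg_on_def prime_power_exps_def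
    by (metis (mono_tags, lifting) bot_nat_0.not_eq_extremum mem_Collect_eq not_one_le_zero sum.neutral)
  have "Poly_Mapping.single (m - Poly_Mapping.single i 1) c * var i \<in> P"
    using m assms(2)[OF i(1)]
    by (intro I(3)) (auto intro: single_in_mono_span exps_minus simp: prime_power_exps_def)
  moreover have "Poly_Mapping.single (m - Poly_Mapping.single i 1) c * var i = Poly_Mapping.single m c"
    using split_off_variable[OF i(2)] by (simp add: var_eq_mon mult_single add.commute)
  ultimately show "Poly_Mapping.single m c \<in> P"
    by simp
qed (use ideal_closed[OF assms(1)] in auto)

section \<open>Edge ideals and their symbolic powers\<close>

definition edge_exps :: "'v ugraph \<Rightarrow> ('v \<Rightarrow>\<^sub>0 nat) set" where
  "edge_exps G = {Poly_Mapping.single i 1 + Poly_Mapping.single j 1 | i j. {i, j} \<in> edges G}"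

definition vertex_cover :: "'v ugraph \<Rightarrow> 'v set \<Rightarrow> bool" where
  "vertex_cover G C \<longleftrightarrow> C \<subseteq> verts G \<and> (\<forall>e\<in>edges G. e \<inter> C \<noteq> {})"

context
  fixes G :: "'v ugraph"
  assumes G: "simple_graph G"
begin

lemma finite_verts: "finite (verts G)"
  using G by (simp add: simple_graph_def)

lemma edgeD: "{i, j} \<in> edges G \<Longrightarrow> i \<in> verts G \<and> j \<in> verts G \<and> i \<noteq> j"
  using G[unfolded simple_graph_def, THEN conjunct2, THEN bspec, of "{i, j}"]
  by (cases "i = j") simp_all

lemma edgeE:
  assumes "e \<in> edges G"
  obtains i j where "e = {i, j}" "i \<noteq> j" "i \<in> verts G" "j \<in> verts G"
  using G[unfolded simple_graph_def, THEN conjunct2, THEN bspec, OF assms] that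
  by (metis card_2_iff insert_subset)

lemma edge_exps_subset: "edge_exps G \<subseteq> exps (verts G)"
  unfolding edge_exps_def by (auto dest: edgeD)

lemma upward_edge: "upward (verts G) (edge_exps G + exps (verts G))"
  by (rule upward_plus_exps[OF edge_exps_subset])

lemma edge_ideal_eq: 
  "(edge_ideal G :: ('v, 'k::comm_ring_1) mpoly set) = mono_span (edge_exps G + exps (verts G))"
proof -
  have "{var i * var j | i j. {i, j} \<in> edges G} = (mon ` edge_exps G :: ('v, 'k) mpoly set)"
    unfolding edge_exps_def by (auto simp: var_eq_mon mult_single)
  then show ?thesis
    unfolding edge_ideal_def using genideal_mons[OF edge_exps_subset] by metis
qed

lemma edge_ideal_subset_prime_on:
  assumes "vertex_cover G C"
  shows "(edge_ideal G :: ('v, 'k::comm_ring_1) mpoly set) \<subseteq> prime_on (verts G) C"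
  unfolding edge_ideal_eq
proof (rule mono_span_mono, rule subsetI)
  fix m
  assume "m \<in> edge_exps G + exps (verts G)"
  then obtain i j b where m: "m = Poly_Mapping.single i 1 + Poly_Mapping.single j 1 + b"
    "{i, j} \<in> edges G" "b \<in> exps (verts G)"
    by (auto simp: edge_exps_def elim!: set_plus_elim)
  have "finite C"
    using assms finite_verts unfolding vertex_cover_def by (meson finite_subset)
  moreover have "i \<in> C \<or> j \<in> C"
    using assms m(2) unfolding vertex_cover_def by fastforce
  ultimately have "1 \<le> deg_on C m"
    by (auto simp: m(1) deg_on_add deg_on_single)
  then show "m \<in> prime_power_exps (verts G) C 1"
    using m edgeD[OF m(2)] by (simp add: prime_power_exps_def)
qed

text \<open>
  A prime ideal that contains $x_i x_j$ contains $x_i$ or $x_j$.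
\<close>

lemma vertex_cover_of_prime:
  fixes P :: "('v, 'k::comm_ring_1) mpoly set"
  assumes "primeideal P (polynomial_ring (verts G))" "edge_ideal G \<subseteq> P"
  shows "vertex_cover G {i \<in> verts G. var i \<in> P}"
  unfolding vertex_cover_def
proof (intro conjI ballI)
  fix e
  assume e: "e \<in> edges G"
  then obtain i j where ij: "e = {i, j}" "i \<in> verts G" "j \<in> verts G"
    by (rule edgeE)
  have "Poly_Mapping.single i 1 + Poly_Mapping.single j 1 \<in> edge_exps G"
    using e ij(1) unfolding edge_exps_def by blast
  from set_plus_intro[OF this zero_in_exps]
  have "var i * var j \<in> (edge_ideal G :: ('v, 'k) mpoly set)"
    unfolding edge_ideal_eq var_eq_mon mult_single mult_1 mon_in_mono_span_iff by simp
  with assms(2) ij have "(var i :: ('v, 'k) mpoly) \<in> P \<or> (var j :: ('v, 'k) mpoly) \<in> P"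
    by (intro primeideal.I_prime[OF assms(1)]) (auto simp: var_eq_mon)
  with ij show "e \<inter> {i \<in> verts G. var i \<in> P} \<noteq> {}"
    by auto
qed auto

end

context
  fixes G :: "'v::linorder ugraph"
  assumes G: "simple_graph G"
begin

lemma var_in_prime_on_iff:
  assumes "C \<subseteq> verts G"
  shows "(var i :: ('v, 'k::idom) mpoly) \<in> prime_on (verts G) C \<longleftrightarrow> i \<in> C"
proof -
  have "finite C"
    using assms finite_verts[OF G] finite_subset by blast
  then show ?thesis
    using assms unfolding var_eq_mon mon_in_mono_span_iff
    by (auto simp: prime_power_exps_def deg_on_single)
qed

text \<open>
  The variables in a prime over the edge ideal form a vertex cover, and they generate a prime over
  the edge ideal that is contained in the given one.
\<close>

lemma minimal_prime_is_prime_on: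
  fixes P :: "('v, 'k::idom) mpoly set"
  assumes "P \<in> minimal_primes (polynomial_ring (verts G)) (edge_ideal G)"
  obtains C where "vertex_cover G C" "P = prime_on (verts G) C"
proof
  let ?C = "{i \<in> verts G. var i \<in> P}"
  have P: "primeideal P (polynomial_ring (verts G))" "edge_ideal G \<subseteq> P"
    "\<And>Q. primeideal Q (polynomial_ring (verts G)) \<Longrightarrow> edge_ideal G \<subseteq> Q \<Longrightarrow> Q \<subseteq> P \<Longrightarrow> Q = P"
    using assms unfolding minimal_primes_def by auto
  show cover: "vertex_cover G ?C"
    by (rule vertex_cover_of_prime[OF G P(1,2)])
  have "prime_on (verts G) ?C \<subseteq> P"
    by (rule prime_on_subset[OF primeideal.axioms(1)[OF P(1)]]) simp
  then show "P = prime_on (verts G) ?C"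
    using P(3)[OF primeideal_prime_on edge_ideal_subset_prime_on[OF G cover]] by simp
qed

lemma prime_on_minimal_cover:
  assumes "vertex_cover G C" and min: "\<And>D. vertex_cover G D \<Longrightarrow> D \<subseteq> C \<Longrightarrow> D = C"
  shows "(prime_on (verts G) C :: ('v, 'k::idom) mpoly set)
    \<in> minimal_primes (polynomial_ring (verts G)) (edge_ideal G)"
proof -
  have C: "C \<subseteq> verts G"
    using assms(1) by (simp add: vertex_cover_def)
  have "Q = prime_on (verts G) C"
    if Q: "primeideal Q (polynomial_ring (verts G))" "edge_ideal G \<subseteq> Q" "Q \<subseteq> prime_on (verts G) C"
    for Q :: "('v, 'k) mpoly set"
  proof -
    have "{i \<in> verts G. var i \<in> Q} \<subseteq> C"
      using Q(3) var_in_prime_on_iff[OF C] by blast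
    then have "{i \<in> verts G. var i \<in> Q} = C"
      by (rule min[OF vertex_cover_of_prime[OF G Q(1,2)]])
    then have "prime_on (verts G) C \<subseteq> Q"
      by (intro prime_on_subset[OF primeideal.axioms(1)[OF Q(1)]]) auto
    with Q(3) show ?thesis
      by simp
  qed
  then show ?thesis
    unfolding minimal_primes_def
    using primeideal_prime_on edge_ideal_subset_prime_on[OF G assms(1)] by blast
qed

text \<open>
  Only minimal covers belong to minimal primes, but every cover contains a minimal one, of smaller
  or equal degree. So the condition can be imposed for all covers.
\<close>

lemma symbolic_power_edge_ideal:
  "(symbolic_power (polynomial_ring (verts G)) (edge_ideal G) k :: ('v, 'k::idom) mpoly set)
    = mono_span {m \<in> exps (verts G). \<forall>C. vertex_cover G C \<longrightarrow> k \<le> deg_on C m}"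
    (is "?L = mono_span ?U")
proof
  let ?S = "polynomial_ring (verts G) :: ('v, 'k) mpoly ring"
  have power: "ideal_power ?S (prime_on (verts G) C) k = mono_span (prime_power_exps (verts G) C k)"
    if "vertex_cover G C" for C
    using that sumset_power_prime[of C "verts G" k] finite_verts[OF G] finite_subset[of C "verts G"]
    unfolding ideal_power_mono_span vertex_cover_def by simp
  show "?L \<subseteq> mono_span ?U"
  proof (intro subsetI mono_spanI)
    fix p :: "('v, 'k) mpoly" and m
    assume p: "p \<in> ?L" and m: "m \<in> Poly_Mapping.keys p"
    have "k \<le> deg_on C m" if C: "vertex_cover G C" for C
    proof -
      have fin: "finite C"
        using C finite_verts[OF G] finite_subset unfolding vertex_cover_def by blast
      obtain D where D: "vertex_cover G D" "D \<subseteq> C" "\<And>E. vertex_cover G E \<Longrightarrow> E \<subseteq> D \<Longrightarrow> E = D"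
        using finite_has_minimal2[of "{D. vertex_cover G D \<and> D \<subseteq> C}" C] fin C
        by simp (metis order_trans)
      have "p \<in> mono_span (prime_power_exps (verts G) D k)"
        using p prime_on_minimal_cover[OF D(1,3)] power[OF D(1)]
        unfolding symbolic_power_def by auto
      then have "k \<le> deg_on D m"
        using m by (auto simp: mono_span_def prime_power_exps_def)
      also have "\<dots> \<le> deg_on C m"
        unfolding deg_on_def using fin D(2) by (rule sum_mono2) simp
      finally show ?thesis .
    qed
    moreover have "m \<in> exps (verts G)"
      using p m by (auto simp: symbolic_power_def mono_span_def)
    ultimately show "m \<in> ?U"
      by simp
  qed
  show "mono_span ?U \<subseteq> ?L"
  proof
    fix p :: "('v, 'k) mpoly"
    assume p: "p \<in> mono_span ?U"
    have "p \<in> ideal_power ?S P k" if P: "P \<in> minimal_primes ?S (edge_ideal G)" for P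
      using P
    proof (rule minimal_prime_is_prime_on)
      fix C
      assume C: "vertex_cover G C" "P = prime_on (verts G) C"
      show ?thesis
        unfolding C(2) power[OF C(1)]
        using p C(1) by (auto simp: mono_span_def prime_power_exps_def)
    qed
    then show "p \<in> ?L"
      using p unfolding symbolic_power_def by (auto simp: mono_span_def)
  qed
qed

end

section \<open>Regular sequences\<close>

lemma (in cring) nonzerodivisor_quotient_iff:
  assumes "ideal L R" "a \<in> carrier R"
  shows "nonzerodivisor (R Quot L) (L +> a) \<longleftrightarrow> (\<forall>b\<in>carrier R. a \<otimes> b \<in> L \<longrightarrow> b \<in> L)"
proof -
  have sub: "L \<subseteq> carrier R"
    using assms(1) by (simp add: additive_subgroup.a_subset ideal.axioms(1))
  have zero: "L +> x = L \<longleftrightarrow> x \<in> L" if "x \<in> carrier R" for x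
    using ideal.rcos_const_imp_mem[OF assms(1)] a_rcos_zero[OF assms(1)] that by blast
  have car: "carrier (R Quot L) = (\<lambda>x. L +> x) ` carrier R"
    by (auto simp: FactRing_def A_RCOSETS_def' image_def)
  have "nonzerodivisor (R Quot L) (L +> a) \<longleftrightarrow>
    (\<forall>b\<in>carrier R. (L +> a) \<otimes>\<^bsub>R Quot L\<^esub> (L +> b) = \<zero>\<^bsub>R Quot L\<^esub> \<longrightarrow> L +> b = \<zero>\<^bsub>R Quot L\<^esub>)"
    unfolding nonzerodivisor_def car using assms(2) by blast
  also have "\<dots> \<longleftrightarrow> (\<forall>b\<in>carrier R. L +> a \<otimes> b = L \<longrightarrow> L +> b = L)"
    using ideal.rcoset_mult_add[OF assms] by (simp add: FactRing_def)
  also have "\<dots> \<longleftrightarrow> (\<forall>b\<in>carrier R. a \<otimes> b \<in> L \<longrightarrow> b \<in> L)"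
    using zero assms(2) by (meson m_closed)
  finally show ?thesis .
qed

lemma (in cring) genideal_insert_ideal:
  assumes J: "ideal J R" and f: "f \<in> carrier R"
  shows "Idl (J \<union> {f}) = {f \<otimes> s \<oplus> j | s j. s \<in> carrier R \<and> j \<in> J}"
proof -
  have sub: "J \<union> {f} \<subseteq> carrier R"
    using assms by (simp add: additive_subgroup.a_subset ideal.axioms(1))
  have "Idl (J \<union> {f}) = Idl (J \<union> PIdl f)"
  proof
    have "f \<in> PIdl f"
      by (rule cgenideal_self[OF f])
    moreover have "J \<union> PIdl f \<subseteq> carrier R"
      using sub cgenideal_ideal[OF f] by (simp add: additive_subgroup.a_subset ideal.axioms(1))
    ultimately show "Idl (J \<union> {f}) \<subseteq> Idl (J \<union> PIdl f)"
      by (intro genideal_minimal genideal_ideal) (use genideal_self in blast)+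
    have "PIdl f \<subseteq> Idl (J \<union> {f})"
      by (rule cgenideal_minimal[OF genideal_ideal[OF sub]]) (use genideal_self[OF sub] in blast)
    then show "Idl (J \<union> PIdl f) \<subseteq> Idl (J \<union> {f})"
      by (intro genideal_minimal genideal_ideal[OF sub]) (use genideal_self[OF sub] in blast)
  qed
  also have "\<dots> = J <+> PIdl f"
    by (rule union_genideal[OF J cgenideal_ideal[OF f]])
  also have "\<dots> = {f \<otimes> s \<oplus> j | s j. s \<in> carrier R \<and> j \<in> J}"
  proof -
    have "j \<oplus> s \<otimes> f = f \<otimes> s \<oplus> j" if "j \<in> J" "s \<in> carrier R" for j s
      using that f sub by (simp add: a_comm m_comm subset_iff)
    then show ?thesis
      unfolding set_add_def' cgenideal_def by fastforce
  qed
  finally show ?thesis .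
qed

lemma (in cring) genideal_ideal_eq: "ideal J R \<Longrightarrow> Idl J = J"
  by (meson additive_subgroup.a_subset equalityI genideal_minimal genideal_self ideal.axioms(1) order_refl)

lemma (in cring) regular_sequence_first_two:
  assumes J: "ideal J R" and reg: "regular_sequence_on_quotient R J fs" and len: "2 \<le> length fs"
  obtains f1 f2 where "f1 \<in> set fs" "f2 \<in> set fs"
    "\<And>b. b \<in> carrier R \<Longrightarrow> f1 \<otimes> b \<in> J \<Longrightarrow> b \<in> J"
    "\<And>b. b \<in> carrier R \<Longrightarrow> f2 \<otimes> b \<in> Idl (J \<union> {f1}) \<Longrightarrow> b \<in> Idl (J \<union> {f1})"
proof
  obtain f1 f2 rest where fs: "fs = f1 # f2 # rest"
    using len by (metis Suc_le_length_iff numeral_2_eq_2)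
  have car: "f1 \<in> carrier R" "f2 \<in> carrier R"
    using reg unfolding regular_sequence_on_quotient_def fs by auto
  show "fs ! 0 \<in> set fs" "fs ! 1 \<in> set fs"
    by (simp_all add: fs)
  have nz: "nonzerodivisor (R Quot Idl (J \<union> set (take i fs))) (Idl (J \<union> set (take i fs)) +> fs ! i)"
    if "i < 2" for i
    using reg that len unfolding regular_sequence_on_quotient_def Let_def by (meson less_le_trans)
  show "b \<in> J" if "b \<in> carrier R" "fs ! 0 \<otimes> b \<in> J" for b
    using nz[of 0] nonzerodivisor_quotient_iff[OF J car(1)] genideal_ideal_eq[OF J] that
    by (simp add: fs)
  have "J \<union> {f1} \<subseteq> carrier R"
    using J car(1) by (simp add: additive_subgroup.a_subset ideal.axioms(1))
  from nonzerodivisor_quotient_iff[OF genideal_ideal[OF this] car(2)]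
  show "b \<in> Idl (J \<union> {fs ! 0})" if "b \<in> carrier R" "fs ! 1 \<otimes> b \<in> Idl (J \<union> {fs ! 0})" for b
    using nz[of 1] that by (simp add: fs)
qed

text \<open>
  The step that bounds depths from above. Multiplied by \<open>u\<close> and modulo \<open>J\<close>, both \<open>f1\<close> and \<open>f2\<close>
  become multiples of the single element \<open>x\<close>, namely $x a_1$ and $x a_2$. Hence
  $f_2 (a_1 u) \equiv x a_1 a_2 u \equiv f_1 (a_2 u)$, and regularity of \<open>f2\<close> gives
  $a_1 u \equiv f_1 u'$ for some \<open>u'\<close>. Multiplying by \<open>x\<close> and cancelling \<open>f1\<close> yields
  $u \equiv x u'$. So, modulo \<open>J\<close>, a regular sequence of length two allows \<open>u\<close> to be divided by
  \<open>x\<close>, and everything that kills \<open>u\<close> kills the quotient \<open>u'\<close> as well.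
\<close>

lemma annihilator_descent:
  fixes V :: "'v set" and J :: "('v, 'k::comm_ring_1) mpoly set"
  defines "R \<equiv> mono_span (exps V) :: ('v, 'k) mpoly set"
  assumes J: "ideal J (polynomial_ring V)"
    and R: "x \<in> R" "a1 \<in> R" "b1 \<in> R" "a2 \<in> R" "b2 \<in> R" "u \<in> R"
    and f: "f1 = x * a1 + b1" "f2 = x * a2 + b2"
    and b: "b1 * u \<in> J" "b2 * u \<in> J"
    and f1: "\<And>p. p \<in> R \<Longrightarrow> f1 * p \<in> J \<Longrightarrow> p \<in> J"
    and f2: "\<And>p. p \<in> R \<Longrightarrow> f2 * p \<in> {f1 * s + j | s j. s \<in> R \<and> j \<in> J}
      \<Longrightarrow> p \<in> {f1 * s + j | s j. s \<in> R \<and> j \<in> J}"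
  shows "\<exists>u'\<in>R. u - x * u' \<in> J \<and> (\<forall>y\<in>R. y * u \<in> J \<longrightarrow> y * u' \<in> J)"
proof -
  note I = ideal_closed[OF J, folded R_def]
  have mult: "p * q \<in> R" if "p \<in> R" "q \<in> R" for p q
    using that unfolding R_def by (rule mult_in_polynomial_ring)
  have diff: "p - q \<in> R" if "p \<in> R" "q \<in> R" for p q
    using that unfolding R_def by (rule diff_in_mono_span)
  have f1R: "f1 \<in> R"
    using R mult unfolding f R_def by (intro add_in_mono_span)
  have "f2 * (a1 * u) = f1 * (a2 * u) + (a1 * (b2 * u) - a2 * (b1 * u))"
    unfolding f by (simp add: algebra_simps)
  moreover have "a1 * (b2 * u) - a2 * (b1 * u) \<in> J"
    by (intro I b R)
  ultimately have "f2 * (a1 * u) \<in> {f1 * s + j | s j. s \<in> R \<and> j \<in> J}"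
    using mult[OF R(4,6)] by blast
  from f2[OF mult[OF R(2,6)] this] obtain u' j where u': "a1 * u = f1 * u' + j" "u' \<in> R" "j \<in> J"
    by blast
  have "f1 * (u - x * u') = x * (a1 * u - f1 * u') + b1 * u"
    unfolding f(1) by (simp add: algebra_simps)
  also have "\<dots> \<in> J"
    using u' I b R by simp
  finally have "u - x * u' \<in> J"
    by (rule f1[OF diff[OF R(6) mult[OF R(1) u'(2)]]])
  moreover have "y * u' \<in> J" if y: "y \<in> R" "y * u \<in> J" for y
  proof (rule f1[OF mult[OF y(1) u'(2)]])
    have "f1 * (y * u') = a1 * (y * u) - y * j"
    proof -
      have "a1 * (y * u) = y * (f1 * u' + j)"
        unfolding u'(1)[symmetric] by (simp add: ac_simps)
      then show ?thesis
        by (simp add: algebra_simps)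
    qed
    also have "\<dots> \<in> J"
      by (rule I(5)[OF I(3)[OF y(2) R(2)] I(3)[OF u'(3) y(1)]])
    finally show "f1 * (y * u') \<in> J" .
  qed
  ultimately show ?thesis
    using u'(2) by blast
qed

lemma variable_ideal_eq:
  "(variable_ideal V :: ('v, 'k::comm_ring_1) mpoly set)
    = mono_span ((\<lambda>i. Poly_Mapping.single i 1) ` V + exps V)"
proof -
  have "var ` V = (mon ` (\<lambda>i. Poly_Mapping.single i 1) ` V :: ('v, 'k) mpoly set)"
    by (simp add: image_image var_eq_mon)
  moreover have "(\<lambda>i. Poly_Mapping.single i 1) ` V \<subseteq> exps V"
    by auto
  ultimately show ?thesis
    unfolding variable_ideal_def by (simp add: genideal_mons)
qed

lemma variable_ideal_split:
  fixes f :: "('v, 'k::comm_ring_1) mpoly"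
  assumes "f \<in> variable_ideal V"
  obtains a b where "f = var q * a + b" "a \<in> mono_span (exps V)"
    "b \<in> mono_span ((\<lambda>i. Poly_Mapping.single i 1) ` (V - {q}) + exps V)"
proof -
  let ?B = "(\<lambda>i. Poly_Mapping.single i 1) ` (V - {q}) + exps V"
  let ?J = "{f :: ('v, 'k) mpoly. \<exists>a\<in>mono_span (exps V). \<exists>b\<in>mono_span ?B. f = var q * a + b}"
  have "mono_span ((\<lambda>i. Poly_Mapping.single i 1) ` V + exps V) \<subseteq> ?J"
  proof (rule mono_span_subsetI)
    show "0 \<in> ?J"
      by (auto intro!: bexI[of _ 0])
    show "f + g \<in> ?J" if fg: "f \<in> ?J" "g \<in> ?J" for f g
    proof -
      obtain a b c d where *: "f = var q * a + b" "g = var q * c + d"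
        "a \<in> mono_span (exps V)" "b \<in> mono_span ?B" "c \<in> mono_span (exps V)" "d \<in> mono_span ?B"
        using fg by blast
      then have "f + g = var q * (a + c) + (b + d)"
        by (simp add: algebra_simps)
      then show ?thesis
        using add_in_mono_span[OF *(3,5)] add_in_mono_span[OF *(4,6)] by blast
    qed
    fix m and c :: 'k
    assume "m \<in> (\<lambda>i. Poly_Mapping.single i 1) ` V + exps V"
    then obtain i e where m: "m = Poly_Mapping.single i 1 + e" "i \<in> V" "e \<in> exps V"
      by (auto elim!: set_plus_elim)
    show "Poly_Mapping.single m c \<in> ?J"
    proof (cases "i = q")
      case True
      then have "Poly_Mapping.single m c = var q * Poly_Mapping.single e c + 0"
        by (simp add: m(1) var_eq_mon mult_single)
      then show ?thesis
        using single_in_mono_span[OF m(3)] zero_in_mono_span by blast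
    next
      case False
      then have "m \<in> ?B"
        using m by (auto intro: set_plus_intro)
      moreover have "Poly_Mapping.single m c = var q * 0 + Poly_Mapping.single m c"
        by simp
      ultimately show ?thesis
        using single_in_mono_span zero_in_mono_span by blast
    qed
  qed
  with assms that show ?thesis
    unfolding variable_ideal_eq by blast
qed

text \<open>
  If all variables but one kill a nonzero monomial of the quotient, then the depth is at most one.
  With a regular sequence of length two, the monomial could be divided by the remaining variable
  again and again without losing this property, although its exponent is finite. The lemma is a
  special case of the bound of the depth by the dimensions of the associated primes.
\<close>

lemma regular_sequence_length_le_one:
  fixes V :: "'v set" and fs :: "('v, 'k::comm_ring_1) mpoly list"
  assumes U: "upward V U"
    and reg: "regular_sequence_on_quotient (polynomial_ring V) (mono_span U) fs"
    and fs: "set fs \<subseteq> variable_ideal V"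
    and w: "w \<in> exps V" "w \<notin> U" "\<And>v. v \<in> V - {q} \<Longrightarrow> Poly_Mapping.single v 1 + w \<in> U" "q \<in> V"
  shows "length fs \<le> 1"
proof (rule ccontr)
  let ?S = "polynomial_ring V :: ('v, 'k) mpoly ring"
  let ?J = "mono_span U :: ('v, 'k) mpoly set"
  interpret cring ?S
    by (rule cring_polynomial_ring)
  have J: "ideal ?J ?S"
    by (rule ideal_mono_span[OF U])
  assume "\<not> length fs \<le> 1"
  then have "2 \<le> length fs"
    by simp
  then obtain f1 f2 where f: "f1 \<in> set fs" "f2 \<in> set fs"
    "\<And>b. b \<in> mono_span (exps V) \<Longrightarrow> f1 * b \<in> ?J \<Longrightarrow> b \<in> ?J"
    "\<And>b. b \<in> mono_span (exps V) \<Longrightarrow> f2 * b \<in> Idl\<^bsub>?S\<^esub> (?J \<union> {f1}) \<Longrightarrow> b \<in> Idl\<^bsub>?S\<^esub> (?J \<union> {f1})"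
    using regular_sequence_first_two[OF J reg] by auto
  have "f1 \<in> carrier ?S"
    using reg f(1) unfolding regular_sequence_on_quotient_def by auto
  from genideal_insert_ideal[OF J this]
  have Idl: "Idl\<^bsub>?S\<^esub> (?J \<union> {f1}) = {f1 * s + j | s j. s \<in> mono_span (exps V) \<and> j \<in> ?J}"
    by simp
  obtain a1 b1 where 1: "f1 = var q * a1 + b1" "a1 \<in> mono_span (exps V)"
    "b1 \<in> mono_span ((\<lambda>i. Poly_Mapping.single i 1) ` (V - {q}) + exps V)"
    by (rule variable_ideal_split[OF subsetD[OF fs f(1)]])
  obtain a2 b2 where 2: "f2 = var q * a2 + b2" "a2 \<in> mono_span (exps V)"
    "b2 \<in> mono_span ((\<lambda>i. Poly_Mapping.single i 1) ` (V - {q}) + exps V)"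
    by (rule variable_ideal_split[OF subsetD[OF fs f(2)]])
  have B: "mono_span ((\<lambda>i. Poly_Mapping.single i 1) ` (V - {q}) + exps V) \<subseteq> (mono_span (exps V) :: ('v, 'k) mpoly set)"
    by (rule mono_span_mono) (auto elim!: set_plus_elim)
  \<comment> \<open>The polynomial \<open>u'\<close> of \<open>annihilator_descent\<close> need not be a monomial. Since the ideal is spanned
    by monomials, a suitable term of \<open>u'\<close> can replace it.\<close>
  have descent: "\<exists>w'. w = Poly_Mapping.single q 1 + w' \<and> w' \<in> exps V \<and> w' \<notin> U \<and>
      (\<forall>v\<in>V - {q}. Poly_Mapping.single v 1 + w' \<in> U)"
    if w: "w \<in> exps V" "w \<notin> U" "\<forall>v\<in>V - {q}. Poly_Mapping.single v 1 + w \<in> U" for w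
  proof -
    have kill: "b * mon w \<in> ?J"
      if b: "b \<in> mono_span ((\<lambda>i. Poly_Mapping.single i 1) ` (V - {q}) + exps V)" for b
    proof (rule subsetD[OF mono_span_mono mult_in_mono_span[OF b, of _ "{w}"]])
      have "Poly_Mapping.single v 1 + e + w \<in> U" if "v \<in> V - {q}" "e \<in> exps V" for v e
        using upwardD[OF U _ that(2), of "Poly_Mapping.single v 1 + w"] w(3) that(1)
        by (simp add: ac_simps)
      then show "(\<lambda>i. Poly_Mapping.single i 1) ` (V - {q}) + exps V + {w} \<subseteq> U"
        by (auto elim!: set_plus_elim)
    qed simp
    have var_q: "var q \<in> mono_span (exps V)" and mon_w: "mon w \<in> mono_span (exps V)"
      using \<open>q \<in> V\<close> w(1) by (simp_all add: var_eq_mon)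
    have "\<exists>u'\<in>mono_span (exps V). mon w - var q * u' \<in> ?J \<and>
        (\<forall>y\<in>mono_span (exps V). y * mon w \<in> ?J \<longrightarrow> y * u' \<in> ?J)"
      by (rule annihilator_descent[OF J var_q 1(2) subsetD[OF B 1(3)] 2(2) subsetD[OF B 2(3)] mon_w
            1(1) 2(1) kill[OF 1(3)] kill[OF 2(3)] f(3) f(4)[unfolded Idl]])
    then obtain u' where u': "u' \<in> mono_span (exps V)" "mon w - var q * u' \<in> ?J"
      "\<And>y. y \<in> mono_span (exps V) \<Longrightarrow> y * mon w \<in> ?J \<Longrightarrow> y * u' \<in> ?J"
      by blast
    have "w \<in> Poly_Mapping.keys (var q * u')"
    proof (rule ccontr)
      assume "w \<notin> Poly_Mapping.keys (var q * u')"
      then have "w \<in> Poly_Mapping.keys (mon w - var q * u')"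
        by (simp add: in_keys_iff lookup_minus)
      then show False
        using u'(2) w(2) by (auto simp: mono_span_def)
    qed
    then obtain w' where w': "w = Poly_Mapping.single q 1 + w'" "w' \<in> Poly_Mapping.keys u'"
      using keys_mult[of "var q" u'] by (auto simp: var_eq_mon)
    have "w' \<in> exps V"
      using u'(1) w'(2) by (auto simp: mono_span_def)
    moreover have "w' \<notin> U"
      using upwardD[OF U, of w' "Poly_Mapping.single q 1"] w(2) w'(1) \<open>q \<in> V\<close> by (auto simp: add.commute)
    moreover have "Poly_Mapping.single v 1 + w' \<in> U" if v: "v \<in> V - {q}" for v
    proof -
      have "var v * u' \<in> ?J"
        by (rule u'(3)) (use v w(3) in \<open>auto simp: var_eq_mon mult_single\<close>)
      moreover have "Poly_Mapping.single v 1 + w' \<in> Poly_Mapping.keys (var v * u')"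
        using w'(2) by (simp add: in_keys_iff var_eq_mon lookup_single_mult del: One_nat_def)
      ultimately show ?thesis
        by (auto simp: mono_span_def)
    qed
    ultimately show ?thesis
      using w'(1) by blast
  qed
  have "\<forall>w. w \<in> exps V \<and> w \<notin> U \<and> (\<forall>v\<in>V - {q}. Poly_Mapping.single v 1 + w \<in> U) \<longrightarrow>
    Poly_Mapping.lookup w q \<noteq> n" for n
  proof (induction n rule: less_induct)
    case (less n)
    show ?case
    proof (intro allI impI notI)
      fix w
      assume w: "w \<in> exps V \<and> w \<notin> U \<and> (\<forall>v\<in>V - {q}. Poly_Mapping.single v 1 + w \<in> U)"
        and n: "Poly_Mapping.lookup w q = n"
      with descent[of w] obtain w' where w': "w = Poly_Mapping.single q 1 + w'" "w' \<in> exps V \<and> w' \<notin> U \<and>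
          (\<forall>v\<in>V - {q}. Poly_Mapping.single v 1 + w' \<in> U)"
        by blast
      have "Poly_Mapping.lookup w' q < n"
        using n by (simp add: w'(1) lookup_add)
      from less.IH[OF this] w'(2) show False
        by blast
    qed
  qed
  with w show False
    by blast
qed

section \<open>Monomials in powers of edge ideals\<close>

abbreviation unit_exp :: "'v \<Rightarrow> ('v \<Rightarrow>\<^sub>0 nat)" where
  "unit_exp i \<equiv> Poly_Mapping.single i 1"

abbreviation adjacency :: "'v ugraph \<Rightarrow> ('v \<times> 'v) set" where
  "adjacency G \<equiv> {(i, j). {i, j} \<in> edges G}"

abbreviation edge_power_exps :: "'v ugraph \<Rightarrow> nat \<Rightarrow> ('v \<Rightarrow>\<^sub>0 nat) set" where
  "edge_power_exps G \<equiv> sumset_power (verts G) (edge_exps G + exps (verts G))"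

lemma sum_unit_exp:
  fixes m :: "'v \<Rightarrow>\<^sub>0 nat"
  assumes "finite V" "m \<in> exps V"
  shows "(\<Sum>x\<in>Sigma V (\<lambda>i. {..<Poly_Mapping.lookup m i}). unit_exp (fst x)) = m"
proof (rule poly_mapping_eqI)
  fix v
  have "(\<Sum>x\<in>Sigma V (\<lambda>i. {..<Poly_Mapping.lookup m i}). unit_exp (fst x))
    = (\<Sum>i\<in>V. \<Sum>t<Poly_Mapping.lookup m i. unit_exp i)"
    using assms(1) by (subst sum.Sigma) (auto simp: case_prod_unfold)
  then have "Poly_Mapping.lookup (\<Sum>x\<in>Sigma V (\<lambda>i. {..<Poly_Mapping.lookup m i}). unit_exp (fst x)) v
    = (\<Sum>i\<in>V. if i = v then Poly_Mapping.lookup m v else 0)"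
    by (simp add: lookup_sum lookup_single when_def) (intro sum.cong, auto)
  also have "\<dots> = Poly_Mapping.lookup m v"
    using assms by (auto simp: exps_def in_keys_iff)
  finally show "Poly_Mapping.lookup (\<Sum>x\<in>Sigma V (\<lambda>i. {..<Poly_Mapping.lookup m i}). unit_exp (fst x)) v
    = Poly_Mapping.lookup m v" .
qed

lemma sum_unit_exp_le:
  assumes "finite A" "A \<subseteq> Poly_Mapping.keys (m :: 'v \<Rightarrow>\<^sub>0 nat)"
  shows "m = (\<Sum>i\<in>A. unit_exp i) + (m - (\<Sum>i\<in>A. unit_exp i))"
proof (rule poly_mapping_eqI)
  fix v
  have "Poly_Mapping.lookup (\<Sum>i\<in>A. unit_exp i) v = (if v \<in> A then 1 else 0)"
    using assms(1) by (simp add: lookup_sum lookup_single when_def)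
  then show "Poly_Mapping.lookup m v
    = Poly_Mapping.lookup ((\<Sum>i\<in>A. unit_exp i) + (m - (\<Sum>i\<in>A. unit_exp i))) v"
    using assms(2) by (auto simp: lookup_add lookup_minus in_keys_iff subset_iff Suc_le_eq)
qed

lemma sum_odd_split:
  fixes h :: "nat \<Rightarrow> 'a::comm_monoid_add"
  shows "(\<Sum>j<2 * r + 1. h j) = h 0 + (\<Sum>t<r. h (2 * t + 1) + h (2 * t + 2))"
  by (induction r) (simp_all add: add.assoc)

lemma sum_rotate:
  fixes h :: "nat \<Rightarrow> 'a::comm_monoid_add"
  assumes "i < m"
  shows "(\<Sum>j<m. h ((i + j) mod m)) = (\<Sum>j<m. h j)"
proof (rule sum.reindex_bij_witness[of _ "\<lambda>l. (l + (m - i)) mod m" "\<lambda>j. (i + j) mod m"])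
  show "((i + j) mod m + (m - i)) mod m = j" if "j \<in> {..<m}" for j
  proof -
    have "((i + j) mod m + (m - i)) mod m = (i + j + (m - i)) mod m"
      by (simp add: mod_add_left_eq)
    also have "i + j + (m - i) = j + m"
      using assms by simp
    finally show ?thesis
      using that by simp
  qed
  show "(i + (l + (m - i)) mod m) mod m = l" if "l \<in> {..<m}" for l
  proof -
    have "(i + (l + (m - i)) mod m) mod m = (i + (l + (m - i))) mod m"
      by (simp add: mod_add_right_eq)
    also have "i + (l + (m - i)) = l + m"
      using assms by simp
    finally show ?thesis
      using that by simp
  qed
qed (use assms in auto)

context
  fixes G :: "'v ugraph"
  assumes G: "simple_graph G"
begin

lemma edge_power_one: "{i, j} \<in> edges G \<Longrightarrow> unit_exp i + unit_exp j \<in> edge_exps G + exps (verts G)"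
  using set_plus_intro[OF _ zero_in_exps, of "unit_exp i + unit_exp j" "edge_exps G" "verts G"]
  unfolding edge_exps_def by auto

lemma upward_edge_power: "upward (verts G) (edge_power_exps G k)"
  by (rule upward_sumset_power[OF upward_edge[OF G]])

lemma induced_cycle_edge:
  assumes "induced_cycle (adjacency G) m c" "i < m"
  shows "{c i, c ((i + 1) mod m)} \<in> edges G"
proof -
  have "(i + 1) mod m < m"
    using assms(2) by simp
  with assms show ?thesis
    unfolding induced_cycle_def by blast
qed

text \<open>
  Without one of its vertices, an odd cycle of length \<open>2 * r + 1\<close> is a path with a perfect matching
  of \<open>r\<close> edges.
\<close>

lemma odd_cycle_sum_split:
  assumes c: "induced_cycle (adjacency G) (2 * r + 1) c" and i: "i < 2 * r + 1"
  obtains p where "(\<Sum>j<2 * r + 1. unit_exp (c j)) = unit_exp (c i) + p" "p \<in> edge_power_exps G r"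
proof
  define g where "g j = c ((i + j) mod (2 * r + 1))" for j
  let ?p = "\<Sum>t<r. unit_exp (g (2 * t + 1)) + unit_exp (g (2 * t + 2))"
  have "(\<Sum>j<2 * r + 1. unit_exp (c j)) = (\<Sum>j<2 * r + 1. unit_exp (g j))"
    unfolding g_def by (rule sum_rotate[OF i, symmetric])
  also have "\<dots> = unit_exp (g 0) + ?p"
    by (rule sum_odd_split)
  also have "g 0 = c i"
    using i by (simp add: g_def)
  finally show "(\<Sum>j<2 * r + 1. unit_exp (c j)) = unit_exp (c i) + ?p" .
  have g: "{g j, g (Suc j)} \<in> edges G" for j
    using induced_cycle_edge[OF c, of "(i + j) mod (2 * r + 1)"] by (simp add: g_def mod_Suc_eq)
  have "?p \<in> edge_power_exps G (card {..<r})"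
    by (rule sum_in_sumset_power)
      (use g[of "2 * _ + 1"] edge_power_one in \<open>auto simp del: One_nat_def\<close>)
  then show "?p \<in> edge_power_exps G r"
    by simp
qed

text \<open>
  The pairs \<open>(i, s)\<close> with \<open>s < Poly_Mapping.lookup m i\<close> are copies of the vertex \<open>i\<close>, as many as the exponent of $x_i$.
  Disjoint edges between such copies are edges of the graph whose product divides the monomial.
\<close>

lemma matching_exponent:
  assumes m: "m \<in> exps (verts G)"
    and M: "finite M" "disjoint M" "\<And>e. e \<in> M \<Longrightarrow> \<exists>i j s t. e = {(i, s), (j, t)} \<and> {i, j} \<in> edges G \<and>
        s < Poly_Mapping.lookup m i \<and> t < Poly_Mapping.lookup m j"
  shows "m \<in> edge_power_exps G (card M)"
proof -
  let ?B = "Sigma (verts G) (\<lambda>i. {..<Poly_Mapping.lookup m i})"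
  let ?h = "\<lambda>x :: 'v \<times> nat. unit_exp (fst x)"
  have sub: "\<Union>M \<subseteq> ?B"
    using M(3) edgeD[OF G] by fastforce
  have finB: "finite ?B"
    using finite_verts[OF G] by simp
  have "m = (\<Sum>x\<in>?B. ?h x)"
    using sum_unit_exp[OF finite_verts[OF G] m] by simp
  also have "\<dots> = (\<Sum>x\<in>\<Union>M. ?h x) + (\<Sum>x\<in>?B - \<Union>M. ?h x)"
    using sum.subset_diff[OF sub finB, of ?h] by (simp add: add.commute)
  also have "(\<Sum>x\<in>\<Union>M. ?h x) = (\<Sum>e\<in>M. \<Sum>x\<in>e. ?h x)"
    using M by (subst sum.Union_disjoint) (force simp: disjoint_def)+
  finally have "m = (\<Sum>e\<in>M. \<Sum>x\<in>e. ?h x) + (\<Sum>x\<in>?B - \<Union>M. ?h x)" .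
  moreover have "(\<Sum>e\<in>M. \<Sum>x\<in>e. ?h x) \<in> edge_power_exps G (card M)"
  proof (rule sum_in_sumset_power[OF M(1)])
    fix e
    assume "e \<in> M"
    then obtain i j s t where e: "e = {(i, s), (j, t)}" "{i, j} \<in> edges G"
      using M(3) by blast
    then have "(\<Sum>x\<in>e. ?h x) = unit_exp i + unit_exp j"
      using edgeD[OF G e(2)] by simp
    with edge_power_one[OF e(2)] show "(\<Sum>x\<in>e. ?h x) \<in> edge_exps G + exps (verts G)"
      by simp
  qed
  moreover from calculation(1) m have "(\<Sum>x\<in>?B - \<Union>M. ?h x) \<in> exps (verts G)"
    by (metis add_in_exps_iff)
  ultimately show ?thesis
    using upwardD[OF upward_edge_power] by metis
qed

text \<open>
  The combinatorial core of the equality of symbolic and ordinary powers. If the support of the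
  monomial is bipartite, Koenig's theorem in the graph of copies gives the \<open>k\<close> edges: a small cover
  of the copies would give a vertex cover of small degree, consisting of the vertices all of whose
  copies are covered. If the support is not bipartite, it contains an induced odd cycle. Its length
  is at least \<open>2 * k + 1\<close>, so the cycle itself contains \<open>k\<close> disjoint edges.
\<close>

lemma cover_weight_imp_edge_power:
  assumes no_cycle: "\<And>r c. 1 \<le> r \<Longrightarrow> r \<le> k - 1 \<Longrightarrow> \<not> induced_cycle (adjacency G) (2 * r + 1) c"
    and m: "m \<in> exps (verts G)" and cover: "\<And>C. vertex_cover G C \<Longrightarrow> k \<le> deg_on C m"
  shows "m \<in> edge_power_exps G k"
proof -
  let ?K = "Poly_Mapping.keys m"
  let ?R = "adjacency G \<inter> ?K \<times> ?K"
  have sym: "sym ?R"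
    by (auto simp: sym_def insert_commute)
  have irrefl: "irrefl ?R"
    unfolding irrefl_def using edgeD[OF G] by blast
  show ?thesis
  proof (cases "\<exists>n v. odd n \<and> (v, v) \<in> ?R ^^ n")
    case True
    then obtain r c where r: "r \<ge> 1" and c: "induced_cycle ?R (2 * r + 1) c"
      using induced_odd_cycle_if_odd_closed_walk[OF sym irrefl] by blast
    have keys: "c i \<in> ?K" if "i < 2 * r + 1" for i
    proof -
      have "(i + 1) mod (2 * r + 1) < 2 * r + 1"
        by simp
      with c that show ?thesis
        unfolding induced_cycle_def by blast
    qed
    have cyc: "induced_cycle (adjacency G) (2 * r + 1) c"
      using c keys unfolding induced_cycle_def by auto
    have "k \<le> r"
      using no_cycle[OF r, of c] cyc by linarith
    obtain p where p: "(\<Sum>j<2 * r + 1. unit_exp (c j)) = unit_exp (c 0) + p" "p \<in> edge_power_exps G r"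
      by (rule odd_cycle_sum_split[OF cyc, of 0]) auto
    have "(\<Sum>i\<in>c ` {..<2 * r + 1}. unit_exp i) = (\<Sum>j<2 * r + 1. unit_exp (c j))"
      using c unfolding induced_cycle_def by (subst sum.reindex) (auto simp: o_def)
    moreover have "\<exists>d. m = (\<Sum>i\<in>c ` {..<2 * r + 1}. unit_exp i) + d"
      by (rule exI, rule sum_unit_exp_le) (use keys in auto)
    ultimately obtain d where d: "m = unit_exp (c 0) + p + d"
      using p(1) by auto
    define b where "b = unit_exp (c 0) + d"
    have b: "m = p + b"
      unfolding d b_def by (simp only: ac_simps)
    then have "m \<in> edge_power_exps G r"
      using upwardD[OF upward_edge_power p(2)] m by simp
    then show ?thesis
      using sumset_power_antimono[OF upward_edge[OF G] \<open>k \<le> r\<close>] by blast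
  next
    case False
    then have "\<exists>col. \<forall>(u, v)\<in>?R. col u \<noteq> (col v :: bool)"
      by (intro two_colouring_if_no_odd_closed_walk[OF sym]) metis
    then obtain col :: "'v \<Rightarrow> bool" where "\<forall>(u, v)\<in>?R. col u \<noteq> col v"
      by (rule exE)
    have col: "col u \<noteq> col v" if "(u, v) \<in> ?R" for u v
      using bspec[OF \<open>\<forall>(u, v)\<in>?R. col u \<noteq> col v\<close> that] by simp
    define E where "E = {{(i, s), (j, t)} | i s j t. {i, j} \<in> edges G \<and>
        s < Poly_Mapping.lookup m i \<and> t < Poly_Mapping.lookup m j}"
    let ?B = "Sigma (verts G) (\<lambda>i. {..<Poly_Mapping.lookup m i})"
    have "E \<subseteq> Pow ?B"
      unfolding E_def using edgeD[OF G] by fastforce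
    then have finE: "finite E"
      by (rule finite_subset) (use finite_verts[OF G] in simp)
    have "\<exists>M\<subseteq>E. card M = k \<and> disjoint M"
    proof (rule koenig[OF finE, of "\<lambda>x. col (fst x)"])
      fix e
      assume "e \<in> E"
      then obtain i s j t where e: "e = {(i, s), (j, t)}" "{i, j} \<in> edges G"
        "s < Poly_Mapping.lookup m i" "t < Poly_Mapping.lookup m j"
        unfolding E_def by blast
      then have "col i \<noteq> col j"
        by (intro col) (auto simp: in_keys_iff)
      with e(1) show "\<exists>u v. e = {u, v} \<and> col (fst u) \<noteq> col (fst v)"
        by (intro exI[of _ "(i, s)"] exI[of _ "(j, t)"]) simp
    next
      fix W :: "('v \<times> nat) set"
      assume W: "finite W" "\<And>e. e \<in> E \<Longrightarrow> e \<inter> W \<noteq> {}"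
      define C where "C = {i \<in> verts G. \<forall>s<Poly_Mapping.lookup m i. (i, s) \<in> W}"
      have finC: "finite C"
        unfolding C_def using finite_verts[OF G] by simp
      have "vertex_cover G C"
        unfolding vertex_cover_def
      proof (intro conjI ballI notI)
        fix e
        assume e: "e \<in> edges G" "e \<inter> C = {}"
        obtain i j where ij: "e = {i, j}" "i \<in> verts G" "j \<in> verts G"
          by (rule edgeE[OF G e(1)])
        then obtain s t where "s < Poly_Mapping.lookup m i" "(i, s) \<notin> W"
          "t < Poly_Mapping.lookup m j" "(j, t) \<notin> W"
          using e(2) unfolding C_def by auto
        moreover from this e(1) ij(1) have "{(i, s), (j, t)} \<in> E"
          unfolding E_def by blast
        ultimately show False
          using W(2)[of "{(i, s), (j, t)}"] by auto
      qed (auto simp: C_def)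
      then have "k \<le> deg_on C m"
        by (rule cover)
      also have "deg_on C m = card (Sigma C (\<lambda>i. {..<Poly_Mapping.lookup m i}))"
        using finC by (simp add: deg_on_def)
      also have "\<dots> \<le> card W"
        using W(1) by (rule card_mono) (auto simp: C_def)
      finally show "k \<le> card W" .
    qed
    then obtain M where M: "M \<subseteq> E" "card M = k" "disjoint M"
      by blast
    have "m \<in> edge_power_exps G (card M)"
      by (rule matching_exponent[OF m finite_subset[OF M(1) finE] M(3)])
        (use M(1) in \<open>auto simp: E_def; blast\<close>)
    then show ?thesis
      by (simp add: M(2))
  qed
qed

end

section \<open>The depth of the powers\<close>

lemma has_induced_copyI:
  assumes "bij_betw g (verts H) W" "W \<subseteq> verts G" "\<And>e. e \<in> edges H \<Longrightarrow> e \<subseteq> verts H"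
    and "{e \<in> edges G. e \<subseteq> W} = (\<lambda>e. g ` e) ` edges H"
  shows "has_induced_copy G H"
  unfolding has_induced_copy_def graph_isomorphic_def
proof (intro exI conjI)
  let ?f = "inv_into (verts H) g"
  show "W \<subseteq> verts G"
    by fact
  show "bij_betw ?f (verts (induced_subgraph G W)) (verts H)"
    using bij_betw_inv_into[OF assms(1)] by (simp add: induced_subgraph_def)
  have "?f ` g ` e = e" if "e \<in> edges H" for e
    using assms(1) assms(3)[OF that] by (intro inv_into_image_cancel) (auto simp: bij_betw_def)
  then show "edges H = (\<lambda>e. ?f ` e) ` edges (induced_subgraph G W)"
    by (simp add: induced_subgraph_def assms(4) image_image cong: image_cong)
qed

context
  fixes G :: "'v ugraph"
  assumes G: "simple_graph G"
begin

lemma induced_cycle_with_two_isolated_vertices: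
  assumes c: "induced_cycle (adjacency G) m c"
    and pq: "p \<in> verts G" "q \<in> verts G" "p \<noteq> q" "{p, q} \<notin> edges G"
    and far: "\<And>i. i < m \<Longrightarrow> {p, c i} \<notin> edges G" "\<And>i. i < m \<Longrightarrow> {q, c i} \<notin> edges G"
  shows "has_induced_copy G (disjoint_union (cycle_graph m) (isolated_vertices 2))"
proof -
  define g :: "nat + nat \<Rightarrow> 'v" where "g = case_sum c (\<lambda>t. if t = 0 then p else q)"
  let ?H = "disjoint_union (cycle_graph m) (isolated_vertices 2)"
  let ?W = "c ` {..<m} \<union> {p, q}"
  have less: "(i + 1) mod m < m" if "i < m" for i
    using that by simp
  note edge = induced_cycle_edge[OF G c]
  have cV: "c i \<in> verts G" if "i < m" for i
    using edgeD[OF G edge[OF that]] by simp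
  have off: "p \<noteq> c i" "q \<noteq> c i" if "i < m" for i
    using edge[OF that] far[OF less[OF that]] by metis+
  have far': "{c i, p} \<notin> edges G" "{c i, q} \<notin> edges G" if "i < m" for i
    using far[OF that] by (simp_all add: insert_commute)
  have "{q, p} \<notin> edges G"
    using pq(4) by (simp add: insert_commute)
  have two: "{..<2} = {0, 1 :: nat}"
    by auto
  have inj: "inj_on c {..<m}"
    using c by (simp add: induced_cycle_def)
  show ?thesis
  proof (rule has_induced_copyI[of g])
    have "verts ?H = Inl ` {..<m} \<union> {Inr 0, Inr 1}"
      by (auto simp: disjoint_union_def cycle_graph_def isolated_vertices_def two)
    moreover have "inj_on g (Inl ` {..<m} \<union> {Inr 0, Inr 1})"
      using inj off pq(3) by (auto simp: inj_on_def g_def)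
    ultimately show "bij_betw g (verts ?H) ?W"
      by (auto simp: bij_betw_def g_def image_Un image_image)
    show "?W \<subseteq> verts G"
      using cV pq by auto
    show "e \<subseteq> verts ?H" if "e \<in> edges ?H" for e
      using that less by (auto simp: disjoint_union_def cycle_graph_def isolated_vertices_def)
    have "edges (cycle_graph m) = (\<lambda>i. {i, (i + 1) mod m}) ` {..<m}"
      by (auto simp: cycle_graph_def)
    then have "(\<lambda>e. g ` e) ` edges ?H = (\<lambda>i. {c i, c ((i + 1) mod m)}) ` {..<m}"
      by (simp add: disjoint_union_def isolated_vertices_def g_def image_image)
    then have "(\<lambda>e. g ` e) ` edges ?H = {{c i, c ((i + 1) mod m)} | i. i < m}"
      by auto
    moreover have "{e \<in> edges G. e \<subseteq> ?W} = {{c i, c ((i + 1) mod m)} | i. i < m}"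
    proof (intro subset_antisym subsetI)
      fix e
      assume "e \<in> {e \<in> edges G. e \<subseteq> ?W}"
      then have e: "e \<in> edges G" "e \<subseteq> ?W"
        by auto
      obtain a b where ab: "e = {a, b}" "a \<noteq> b"
        by (rule edgeE[OF G e(1)])
      have "a \<notin> {p, q}" "b \<notin> {p, q}"
        using e ab pq(3,4) far far' \<open>{q, p} \<notin> edges G\<close> by auto
      then have "a \<in> c ` {..<m}" "b \<in> c ` {..<m}"
        using e(2) ab(1) by auto
      then obtain i j where ij: "a = c i" "b = c j" "i < m" "j < m"
        by blast
      with c e(1) ab(1) have "j = (i + 1) mod m \<or> i = (j + 1) mod m"
        unfolding induced_cycle_def by blast
      then show "e \<in> {{c i, c ((i + 1) mod m)} | i. i < m}"
        using ij ab(1) by (auto simp: insert_commute)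
    next
      fix e
      assume "e \<in> {{c i, c ((i + 1) mod m)} | i. i < m}"
      then show "e \<in> {e \<in> edges G. e \<subseteq> ?W}"
        using edge less by auto
    qed
    ultimately show "{e \<in> edges G. e \<subseteq> ?W} = (\<lambda>e. g ` e) ` edges ?H"
      by simp
  qed
qed

text \<open>
  The monomial is the product of the variables of the cycle and of \<open>k - 1 - r\<close> copies of one of its
  edges. Its degree \<open>2 * k - 1\<close> is odd, and one more variable adjacent to the cycle completes it to a
  product of \<open>k\<close> edges. The last property gives the value of every additive weight that is one on the
  cycle.
\<close>

lemma odd_cycle_witness:
  assumes c: "induced_cycle (adjacency G) (2 * r + 1) c" and r: "r \<le> k - 1" and k: "1 \<le> k"
  obtains f where "f \<in> edge_power_exps G (k - 1)"
    "\<forall>i<2 * r + 1. \<forall>v. {v, c i} \<in> edges G \<longrightarrow> unit_exp v + f \<in> edge_power_exps G k"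
    "\<forall>w :: ('v \<Rightarrow>\<^sub>0 nat) \<Rightarrow> nat. (\<forall>a b. w (a + b) = w a + w b) \<longrightarrow>
      (\<forall>i<2 * r + 1. w (unit_exp (c i)) = 1) \<longrightarrow> w f + 1 = 2 * k"
proof
  define d where "d = k - 1 - r"
  define F where "F = (\<Sum>j<2 * r + 1. unit_exp (c j))"
  define e where "e = unit_exp (c 0) + unit_exp (c (1 mod (2 * r + 1)))"
  define D where "D = (\<Sum>t<d. e)"
  have k_eq: "k = 1 + r + d"
    using r k unfolding d_def by linarith
  have edge0: "{c 0, c (1 mod (2 * r + 1))} \<in> edges G"
    using induced_cycle_edge[OF G c, of 0] by simp
  have "D \<in> edge_power_exps G (card {..<d})"
    unfolding D_def e_def by (rule sum_in_sumset_power[OF finite_lessThan edge_power_one[OF G edge0]])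
  then have D: "D \<in> edge_power_exps G d"
    by simp
  have cV: "c i \<in> verts G" if "i < 2 * r + 1" for i
    using edgeD[OF G induced_cycle_edge[OF G c that]] by simp
  have F: "F \<in> edge_power_exps G r"
  proof -
    obtain p where "F = unit_exp (c 0) + p" "p \<in> edge_power_exps G r"
      unfolding F_def by (rule odd_cycle_sum_split[OF G c, of 0]) auto
    then show ?thesis
      using upwardD[OF upward_edge_power[OF G], of p r "unit_exp (c 0)"] cV[of 0] by (simp add: add.commute)
  qed
  show "F + D \<in> edge_power_exps G (k - 1)"
    using add_in_sumset_power[OF upward_edge[OF G] F D] by (simp add: k_eq)
  show "\<forall>i<2 * r + 1. \<forall>v. {v, c i} \<in> edges G \<longrightarrow> unit_exp v + (F + D) \<in> edge_power_exps G k"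
  proof (intro allI impI)
    fix i v
    assume i: "i < 2 * r + 1" and v: "{v, c i} \<in> edges G"
    obtain p where p: "F = unit_exp (c i) + p" "p \<in> edge_power_exps G r"
      unfolding F_def by (rule odd_cycle_sum_split[OF G c i])
    have "unit_exp v + unit_exp (c i) \<in> edge_power_exps G 1"
      using set_plus_intro[OF zero_in_exps edge_power_one[OF G v], of "verts G"] by simp
    then have "(unit_exp v + unit_exp (c i)) + p \<in> edge_power_exps G (1 + r)"
      by (rule add_in_sumset_power[OF upward_edge[OF G] _ p(2)])
    then have "((unit_exp v + unit_exp (c i)) + p) + D \<in> edge_power_exps G (1 + r + d)"
      by (rule add_in_sumset_power[OF upward_edge[OF G] _ D])
    then show "unit_exp v + (F + D) \<in> edge_power_exps G k"
      by (simp only: p(1) k_eq add.assoc)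
  qed
  show "\<forall>w :: ('v \<Rightarrow>\<^sub>0 nat) \<Rightarrow> nat. (\<forall>a b. w (a + b) = w a + w b) \<longrightarrow>
      (\<forall>i<2 * r + 1. w (unit_exp (c i)) = 1) \<longrightarrow> w (F + D) + 1 = 2 * k"
  proof (intro allI impI)
    fix w :: "('v \<Rightarrow>\<^sub>0 nat) \<Rightarrow> nat"
    assume add: "\<forall>a b. w (a + b) = w a + w b" and one: "\<forall>i<2 * r + 1. w (unit_exp (c i)) = 1"
    have w0: "w 0 = 0"
      using add[rule_format, of 0 0] by simp
    have sum: "w (sum g A) = (\<Sum>x\<in>A. w (g x))" if "finite A" for g :: "nat \<Rightarrow> _" and A
      using that by (induction A rule: finite_induct) (simp_all add: add w0)
    have "w F = 2 * r + 1"
    proof -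
      have "w F = (\<Sum>j<2 * r + 1. w (unit_exp (c j)))"
        unfolding F_def by (rule sum[OF finite_lessThan])
      also have "\<dots> = (\<Sum>j<2 * r + 1. 1)"
        by (rule sum.cong) (use one in auto)
      finally show ?thesis
        by simp
    qed
    moreover have "w D = 2 * d"
      unfolding D_def e_def using one by (simp add: sum add)
    ultimately show "w (F + D) + 1 = 2 * k"
      by (simp add: add k_eq)
  qed
qed

lemma edge_power_weight:
  fixes w :: "('v \<Rightarrow>\<^sub>0 nat) \<Rightarrow> nat"
  assumes add: "\<And>a b. w (a + b) = w a + w b"
    and edge: "\<And>i j. {i, j} \<in> edges G \<Longrightarrow> 2 \<le> w (unit_exp i) + w (unit_exp j)"
    and m: "m \<in> edge_power_exps G k"
  shows "2 * k \<le> w m"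
proof (rule sumset_power_weight[OF add _ m])
  fix a
  assume "a \<in> edge_exps G + exps (verts G)"
  then obtain i j b where "a = unit_exp i + unit_exp j + b" "{i, j} \<in> edges G"
    by (auto simp: edge_exps_def elim!: set_plus_elim)
  with edge show "2 \<le> w a"
    by (simp add: add trans_le_add1)
qed

text \<open>
  The monomial \<open>f\<close> of \<open>odd_cycle_witness\<close> is killed by the variables adjacent to the cycle. These
  are all the variables, or there are others, which form a clique. In the second case let \<open>q\<close> be one
  of the others: the monomial $x_q f$ is killed by every other variable $x_v$ of the clique too,
  since $x_v x_q$ is an edge and \<open>f\<close> lies in the power \<open>k - 1\<close>. Weights show that these monomials are
  not in the \<open>k\<close>-th power.
\<close>

lemma socle_up_to_one_variable:
  assumes c: "induced_cycle (adjacency G) (2 * r + 1) c" and r: "1 \<le> r" "r \<le> k - 1"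
    and clique: "\<And>p q. p \<in> verts G \<Longrightarrow> q \<in> verts G \<Longrightarrow> p \<noteq> q \<Longrightarrow>
      (\<And>i. i < 2 * r + 1 \<Longrightarrow> {p, c i} \<notin> edges G) \<Longrightarrow> (\<And>i. i < 2 * r + 1 \<Longrightarrow> {q, c i} \<notin> edges G) \<Longrightarrow>
      {p, q} \<in> edges G"
  obtains w q where "w \<in> exps (verts G)" "q \<in> verts G" "w \<notin> edge_power_exps G k"
    "\<And>v. v \<in> verts G - {q} \<Longrightarrow> unit_exp v + w \<in> edge_power_exps G k"
proof -
  have k: "1 \<le> k" "k = Suc (k - 1)"
    using r by linarith+
  obtain f where f: "f \<in> edge_power_exps G (k - 1)"
    "\<forall>i<2 * r + 1. \<forall>v. {v, c i} \<in> edges G \<longrightarrow> unit_exp v + f \<in> edge_power_exps G k"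
    "\<forall>w :: ('v \<Rightarrow>\<^sub>0 nat) \<Rightarrow> nat. (\<forall>a b. w (a + b) = w a + w b) \<longrightarrow>
      (\<forall>i<2 * r + 1. w (unit_exp (c i)) = 1) \<longrightarrow> w f + 1 = 2 * k"
    by (rule odd_cycle_witness[OF c r(2) k(1)])
  have fV: "f \<in> exps (verts G)"
    using f(1) upward_edge_power[OF G, of "k - 1"] unfolding upward_def by blast
  have cV: "c i \<in> verts G" if "i < 2 * r + 1" for i
    using edgeD[OF G induced_cycle_edge[OF G c that]] by simp
  note fin = finite_verts[OF G]
  define far where "far v \<longleftrightarrow> (\<forall>i<2 * r + 1. {v, c i} \<notin> edges G)" for v
  show ?thesis
  proof (cases "\<exists>q\<in>verts G. far q")
    case False
    have "f \<notin> edge_power_exps G k"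
    proof
      assume "f \<in> edge_power_exps G k"
      then have "2 * k \<le> deg_on (verts G) f"
        by (rule edge_power_weight[OF deg_on_add, rotated])
          (use fin edgeD[OF G] in \<open>auto simp: deg_on_single\<close>)
      moreover have "deg_on (verts G) f + 1 = 2 * k"
        by (rule f(3)[rule_format]) (use fin cV in \<open>auto simp: deg_on_add deg_on_single\<close>)
      ultimately show False
        by simp
    qed
    moreover have "unit_exp v + f \<in> edge_power_exps G k" if "v \<in> verts G" for v
      using False that f(2) unfolding far_def by blast
    ultimately show ?thesis
      using that[of f "c 0"] fV cV[of 0] by simp
  next
    case True
    then obtain q where q: "q \<in> verts G" "far q"
      by blast
    \<comment> \<open>The weight is zero at \<open>q\<close>, two at the neighbours of \<open>q\<close> and one elsewhere, so that every edge
      has weight at least two although \<open>q\<close> does not count.\<close>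
    let ?N = "{v \<in> verts G. {q, v} \<in> edges G}"
    define w where "w m = deg_on (verts G - {q}) m + deg_on ?N m" for m :: "'v \<Rightarrow>\<^sub>0 nat"
    have w_add: "w (a + b) = w a + w b" for a b
      by (simp add: w_def deg_on_add)
    have w_unit: "w (unit_exp v) = (if v = q then 0 else if {q, v} \<in> edges G then 2 else 1)"
      if "v \<in> verts G" for v
      using that fin edgeD[OF G, of q q] by (auto simp: w_def deg_on_single)
    have "unit_exp q + f \<notin> edge_power_exps G k"
    proof
      assume *: "unit_exp q + f \<in> edge_power_exps G k"
      have "2 \<le> w (unit_exp i) + w (unit_exp j)" if "{i, j} \<in> edges G" for i j
        using w_unit edgeD[OF G that] that by (auto simp: insert_commute)
      from edge_power_weight[OF w_add this *] have "2 * k \<le> w f"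
        using w_unit[OF q(1)] by (simp add: w_add)
      moreover have "w f + 1 = 2 * k"
      proof (rule f(3)[rule_format, OF w_add])
        fix i
        assume i: "i < 2 * r + 1"
        have "c i \<noteq> q"
          using q(2) induced_cycle_edge[OF G c i] unfolding far_def by fastforce
        then show "w (unit_exp (c i)) = 1"
          using q(2) i w_unit[OF cV[OF i]] unfolding far_def by simp
      qed
      ultimately show False
        by simp
    qed
    moreover have "unit_exp v + (unit_exp q + f) \<in> edge_power_exps G k" if v: "v \<in> verts G - {q}" for v
    proof (cases "far v")
      case True
      then have "{v, q} \<in> edges G"
        using clique[of v q] v q unfolding far_def by blast
      then have "f + (unit_exp v + unit_exp q) \<in> edge_power_exps G (Suc (k - 1))"
        unfolding sumset_power.simps by (intro set_plus_intro[OF f(1)] edge_power_one[OF G])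
      then show ?thesis
        using k(2) by (simp add: ac_simps)
    next
      case False
      then have "unit_exp v + f \<in> edge_power_exps G k"
        using f(2) unfolding far_def by blast
      then have "(unit_exp v + f) + unit_exp q \<in> edge_power_exps G k"
        by (rule upwardD[OF upward_edge_power[OF G]]) (use q(1) in simp)
      then show ?thesis
        by (simp add: ac_simps)
    qed
    ultimately show ?thesis
      using that[of "unit_exp q + f" q] fV q(1) by simp
  qed
qed

lemma depth_edge_power_le_one:
  assumes c: "induced_cycle (adjacency G) (2 * r + 1) c" and r: "1 \<le> r" "r \<le> k - 1"
    and no_copy: "\<not> has_induced_copy G (disjoint_union (cycle_graph (2 * r + 1)) (isolated_vertices 2))"
  shows "depth_quotient (polynomial_ring (verts G)) (variable_ideal (verts G))
    (ideal_power (polynomial_ring (verts G)) (edge_ideal G :: ('v, 'k::comm_ring_1) mpoly set) k) \<le> 1"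
proof -
  obtain w q where w: "w \<in> exps (verts G)" "q \<in> verts G" "w \<notin> edge_power_exps G k"
    "\<And>v. v \<in> verts G - {q} \<Longrightarrow> unit_exp v + w \<in> edge_power_exps G k"
    using induced_cycle_with_two_isolated_vertices[OF c] no_copy
    by (rule_tac socle_up_to_one_variable[OF c r]) blast+
  show ?thesis
    unfolding depth_quotient_def edge_ideal_eq[OF G] ideal_power_mono_span
  proof (rule SUP_least)
    fix fs
    assume "fs \<in> {fs. regular_sequence_on_quotient (polynomial_ring (verts G))
      (mono_span (edge_power_exps G k) :: ('v, 'k) mpoly set) fs \<and> set fs \<subseteq> variable_ideal (verts G)}"
    then have "length fs \<le> 1"
      using regular_sequence_length_le_one[OF upward_edge_power[OF G] _ _ w(1,3,4,2)] by blast
    then show "enat (length fs) \<le> 1"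
      by (simp add: one_enat_def)
  qed
qed

end

text \<open>
  The sum of all variables is regular modulo the symbolic power: the powers of the minimal primes
  are primary, and no minimal prime contains all variables because a proper subset of the vertices
  is already a cover.
\<close>

lemma one_le_depth_symbolic_power:
  fixes G :: "'v::linorder ugraph"
  assumes G: "simple_graph G" and ne: "verts G \<noteq> {}" and k: "1 \<le> k"
  shows "1 \<le> depth_quotient (polynomial_ring (verts G)) (variable_ideal (verts G))
    (symbolic_power (polynomial_ring (verts G)) (edge_ideal G :: ('v, 'k::idom) mpoly set) k)"
proof -
  let ?V = "verts G"
  let ?S = "polynomial_ring ?V :: ('v, 'k) mpoly ring"
  let ?U = "{m \<in> exps ?V. \<forall>C. vertex_cover G C \<longrightarrow> k \<le> deg_on C m}"
  let ?J = "mono_span ?U :: ('v, 'k) mpoly set"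
  let ?f = "\<Sum>v\<in>?V. var v :: ('v, 'k) mpoly"
  interpret cring ?S
    by (rule cring_polynomial_ring)
  note fin = finite_verts[OF G]
  have J: "ideal ?J ?S"
    by (rule ideal_mono_span) (auto simp: upward_def deg_on_add trans_le_add1 elim!: set_plus_elim)
  have f_in: "?f \<in> mono_span U" if "\<And>v. v \<in> ?V \<Longrightarrow> unit_exp v \<in> U" for U
  proof -
    have "(\<Sum>v\<in>A. var v :: ('v, 'k) mpoly) \<in> mono_span U" if "finite A" "A \<subseteq> ?V" for A
      using that \<open>\<And>v. v \<in> ?V \<Longrightarrow> unit_exp v \<in> U\<close>
      by induction (auto intro!: add_in_mono_span simp: var_eq_mon simp del: One_nat_def)
    then show ?thesis
      using fin by blast
  qed
  have f_car: "?f \<in> carrier ?S"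
    using f_in[of "exps ?V"] by simp
  have lookup_f: "Poly_Mapping.lookup ?f (unit_exp v) = 1" if "v \<in> ?V" for v
  proof -
    have "Poly_Mapping.lookup ?f (unit_exp v) = (\<Sum>u\<in>?V. if u = v then 1 else 0)"
      unfolding lookup_sum by (intro sum.cong) (auto simp: var_eq_mon lookup_single when_def dest!: arg_cong[of _ _ Poly_Mapping.keys])
    then show ?thesis
      using fin that by simp
  qed
  have whole_cover: "vertex_cover G ?V"
    unfolding vertex_cover_def using G by (auto elim: edgeE[OF G])
  have nzd: "b \<in> ?J" if b: "b \<in> mono_span (exps ?V)" "?f * b \<in> ?J" for b
  proof (rule mono_spanI)
    fix m
    assume m: "m \<in> Poly_Mapping.keys b"
    have small: "k \<le> deg_on C m" if C: "vertex_cover G C" "v \<in> ?V - C" for C v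
    proof -
      have CV: "C \<subseteq> ?V"
        using C(1) by (simp add: vertex_cover_def)
      have "?f \<notin> prime_on ?V C"
      proof
        assume "?f \<in> prime_on ?V C"
        moreover have "unit_exp v \<in> Poly_Mapping.keys ?f"
          using lookup_f[of v] C(2) by (simp add: in_keys_iff)
        ultimately have "1 \<le> deg_on C (unit_exp v)"
          by (auto simp: mono_span_def prime_power_exps_def)
        then show False
          using C(2) finite_subset[OF CV fin] by (simp add: deg_on_single)
      qed
      moreover have "?f * b \<in> mono_span (prime_power_exps ?V C k)"
        using b(2) C(1) by (auto simp: mono_span_def prime_power_exps_def)
      ultimately have "b \<in> mono_span (prime_power_exps ?V C k)"
        using prime_on_primary[of ?f ?V b C k] f_car b(1) by simp
      then show ?thesis
        using m by (auto simp: mono_span_def prime_power_exps_def)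
    qed
    have "k \<le> deg_on C m" if C: "vertex_cover G C" for C
    proof (cases "C = ?V")
      case True
      obtain v where v: "v \<in> ?V"
        using ne by blast
      have "vertex_cover G (?V - {v})"
        unfolding vertex_cover_def by (auto elim!: edgeE[OF G])
      then have "k \<le> deg_on (?V - {v}) m"
        by (rule small) (use v in auto)
      also have "\<dots> \<le> deg_on ?V m"
        unfolding deg_on_def using fin by (rule sum_mono2) auto
      finally show ?thesis
        using True by simp
    next
      case False
      then obtain v where "v \<in> ?V - C"
        using C unfolding vertex_cover_def by blast
      then show ?thesis
        by (rule small[OF C])
    qed
    then show "m \<in> ?U"
      using b(1) m by (auto simp: mono_span_def)
  qed
  have "Idl\<^bsub>?S\<^esub> (?J \<union> {?f}) \<subseteq> prime_on ?V ?V"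
  proof (rule genideal_minimal)
    show "ideal (prime_on ?V ?V :: ('v, 'k) mpoly set) ?S"
      by (rule ideal_mono_span[OF upward_prime_power_exps])
    have "?J \<subseteq> prime_on ?V ?V"
      using whole_cover k by (intro mono_span_mono) (auto simp: prime_power_exps_def intro: order_trans)
    moreover have "?f \<in> prime_on ?V ?V"
      by (rule f_in) (use fin in \<open>simp add: prime_power_exps_def deg_on_single\<close>)
    ultimately show "?J \<union> {?f} \<subseteq> prime_on ?V ?V"
      by simp
  qed
  then have proper: "Idl\<^bsub>?S\<^esub> (?J \<union> {?f}) \<noteq> carrier ?S"
    using primeideal.I_notcarr[OF primeideal_prime_on, of ?V ?V]
      ideal_closed(4)[OF primeideal.axioms(1)[OF primeideal_prime_on], of ?V ?V] by auto
  have "regular_sequence_on_quotient ?S ?J [?f]"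
    unfolding regular_sequence_on_quotient_def
    using f_car proper genideal_ideal_eq[OF J] nonzerodivisor_quotient_iff[OF J f_car] nzd by simp
  moreover have "?f \<in> variable_ideal ?V"
    unfolding variable_ideal_eq
    by (rule f_in) (use set_plus_intro[OF imageI zero_in_exps] in fastforce)
  ultimately have "enat (length [?f]) \<le> depth_quotient ?S (variable_ideal ?V) ?J"
    unfolding depth_quotient_def by (intro SUP_upper) auto
  then show ?thesis
    unfolding symbolic_power_edge_ideal[OF G] by (simp add: one_enat_def)
qed

text \<open>
  One inclusion is \<open>cover_weight_imp_edge_power\<close>. For the other, the degree on a cover is at least
  one on every generator of the edge ideal.
\<close>

lemma symbolic_power_eq_power:
  fixes G :: "'v::linorder ugraph"
  assumes G: "simple_graph G"
    and no_cycle: "\<And>r c. 1 \<le> r \<Longrightarrow> r \<le> k - 1 \<Longrightarrow> \<not> induced_cycle (adjacency G) (2 * r + 1) c"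
  shows "symbolic_power (polynomial_ring (verts G)) (edge_ideal G :: ('v, 'k::idom) mpoly set) k
    = ideal_power (polynomial_ring (verts G)) (edge_ideal G) k"
proof -
  have "{m \<in> exps (verts G). \<forall>C. vertex_cover G C \<longrightarrow> k \<le> deg_on C m} = edge_power_exps G k"
  proof (intro subset_antisym subsetI)
    fix m
    assume "m \<in> {m \<in> exps (verts G). \<forall>C. vertex_cover G C \<longrightarrow> k \<le> deg_on C m}"
    then show "m \<in> edge_power_exps G k"
      using cover_weight_imp_edge_power[OF G no_cycle] by blast
  next
    fix m
    assume m: "m \<in> edge_power_exps G k"
    have "k \<le> deg_on C m" if C: "vertex_cover G C" for C
    proof -
      have "edge_exps G + exps (verts G) \<subseteq> prime_power_exps (verts G) C 1"
        using edge_ideal_subset_prime_on[OF G C, where 'k = 'k]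
        unfolding edge_ideal_eq[OF G] mono_span_subset_iff .
      then have "1 * k \<le> deg_on C m"
        by (intro sumset_power_weight[OF deg_on_add _ m]) (auto simp: prime_power_exps_def)
      then show ?thesis
        by simp
    qed
    moreover have "m \<in> exps (verts G)"
      using m upward_edge_power[OF G] unfolding upward_def by blast
    ultimately show "m \<in> {m \<in> exps (verts G). \<forall>C. vertex_cover G C \<longrightarrow> k \<le> deg_on C m}"
      by simp
  qed
  then show ?thesis
    unfolding symbolic_power_edge_ideal[OF G] unfolding edge_ideal_eq[OF G] ideal_power_mono_span by simp
qed

theorem corollary4p11:
  fixes G :: "nat ugraph" and n k :: nat
    and S :: "(nat, 'k::field) mpoly ring"
    and \<mm> I :: "(nat, 'k) mpoly set"
  assumes "simple_graph G" and "verts G = {1..n}"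
    and "k \<ge> 2"
    and "\<And>r. 1 \<le> r \<Longrightarrow> r \<le> k - 1 \<Longrightarrow>
           \<not> has_induced_copy G (disjoint_union (cycle_graph (2 * r + 1)) (isolated_vertices 2))"
    and "S = polynomial_ring {1..n}" and "\<mm> = variable_ideal {1..n}" and "I = edge_ideal G"
  shows "depth_quotient S \<mm> (symbolic_power S I k) \<ge> depth_quotient S \<mm> (ideal_power S I k)"
proof (cases "\<exists>r c. 1 \<le> r \<and> r \<le> k - 1 \<and> induced_cycle (adjacency G) (2 * r + 1) c")
  case True
  then obtain r c where r: "1 \<le> r" "r \<le> k - 1" and c: "induced_cycle (adjacency G) (2 * r + 1) c"
    by blast
  have "verts G \<noteq> {}"
    using edgeD[OF assms(1) induced_cycle_edge[OF assms(1) c, of 0]] by auto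
  then have "1 \<le> depth_quotient S \<mm> (symbolic_power S I k)"
    using one_le_depth_symbolic_power[OF assms(1), of k] assms by simp
  moreover have "depth_quotient S \<mm> (ideal_power S I k) \<le> 1"
    using depth_edge_power_le_one[OF assms(1) c r assms(4)[OF r]] assms by simp
  ultimately show ?thesis
    by (rule order_trans[rotated])
next
  case False
  then have "symbolic_power S I k = ideal_power S I k"
    using symbolic_power_eq_power[OF assms(1), of k] assms by auto
  then show ?thesis
    by simp
qed

end
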